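(* Let $X$ and $Y$ be Banach spaces, let $-A$ be the generator of an exponentially stable analytic semigroup $(T(t))_{t\ge 0}$ on $X$, and let $C : D(A) \to Y$ be a linear operator that is bounded when $D(A)$ carries the graph norm. Then the following conditions are equivalent. (a) (Weiss condition) The operators $\mathrm{Re}(\lambda)^{1/2}\, C(\lambda+A)^{-1}$, $\mathrm{Re}(\lambda)>0$, are uniformly bounded in $B(X,Y)$, i.e. $\sup_{\mathrm{Re}(\lambda)>0} \| \mathrm{Re}(\lambda)^{1/2}\, C(\lambda+A)^{-1}\|_{B(X,Y)} < \infty$. (b) There is a constant $K>0$ such that $\|C T(t)x\|_Y \le K\, t^{-1/2}\, \|x\|_X$ for all $t>0$ and all $x\in X$. (c) $C$ is $L^{2,\infty}$-admissible, i.e. the mapping $x \mapsto C T(\cdot)x$ is continuous from $X$ to $L^{2,\infty}(\mathbb{R}_+;Y)$.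
   Context: A semigroup $(T(t))_{t\ge0}$ here is a strongly continuous semigroup of bounded linear operators; it is exponentially stable if there are $M\ge 1$, $\omega>0$ with $\|T(t)\|\le M e^{-\omega t}$ for all $t\ge 0$. Since the semigroup is analytic, $T(t)X\subset D(A)$ for every $t>0$, so $CT(t)x$ is defined for all $x\in X$ and $t>0$. $B(X,Y)$ denotes the bounded linear operators from $X$ to $Y$. For a measurable function $f:\Omega\to Y$ on a measure space $(\Omega,\mu)$ the distribution function is $d_f(\alpha)=\mu(\{\omega\in\Omega : \|f(\omega)\|>\alpha\})$. The weak Lebesgue space $L^{2,\infty}(\Omega;Y)$ is the space of measurable functions $f:\Omega\to Y$ with finite quasi-norm $\|f\|_{L^{2,\infty}(\Omega;Y)}=\sup\{\alpha\, d_f(\alpha)^{1/2} : \alpha>0\}$. On $\mathbb{R}_+=[0,\infty)$ the measure is Lebesgue measure. *)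

theory Defs
  imports "HOL-Analysis.Analysis"
begin

text \<open>Complex Banach spaces; the real structure underlying the complex one is that of \<^class>\<open>banach\<close>.\<close>

class complex_banach = banach +
  fixes scaleC :: "complex \<Rightarrow> 'a \<Rightarrow> 'a"  (infixr "*\<^sub>C" 75)
  assumes scaleC_add_right: "a *\<^sub>C (x + y) = a *\<^sub>C x + a *\<^sub>C y"
    and scaleC_add_left: "(a + b) *\<^sub>C x = a *\<^sub>C x + b *\<^sub>C x"
    and scaleC_scaleC: "a *\<^sub>C b *\<^sub>C x = (a * b) *\<^sub>C x"
    and scaleC_of_real: "complex_of_real r *\<^sub>C x = r *\<^sub>R x"
    and norm_scaleC: "norm (a *\<^sub>C x) = cmod a * norm x"

instantiation complex :: complex_banach
begin

definition scaleC_complex :: "complex \<Rightarrow> complex \<Rightarrow> complex"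
  where "scaleC_complex = (*)"

instance
  by standard (simp_all add: scaleC_complex_def algebra_simps norm_mult scaleR_conv_of_real)

end

definition bounded_clinear :: "('a::complex_banach \<Rightarrow> 'b::complex_banach) \<Rightarrow> bool"
  where "bounded_clinear f \<longleftrightarrow> bounded_linear f \<and> (\<forall>c x. f (c *\<^sub>C x) = c *\<^sub>C f x)"

text \<open>
  An unbounded operator is a domain \<open>D\<close> together with a total function of which only the
  values on \<open>D\<close> are meaningful.
\<close>

definition clinear_on :: "'a::complex_banach set \<Rightarrow> ('a \<Rightarrow> 'b::complex_banach) \<Rightarrow> bool"
  where "clinear_on D f \<longleftrightarrow>
    (\<forall>x\<in>D. \<forall>y\<in>D. f (x + y) = f x + f y) \<and> (\<forall>c. \<forall>x\<in>D. f (c *\<^sub>C x) = c *\<^sub>C f x)"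

definition graph_bounded ::
    "'a::complex_banach set \<Rightarrow> ('a \<Rightarrow> 'a) \<Rightarrow> ('a \<Rightarrow> 'b::complex_banach) \<Rightarrow> bool"
  where "graph_bounded D A C \<longleftrightarrow> (\<exists>K. \<forall>x\<in>D. norm (C x) \<le> K * (norm x + norm (A x)))"

definition c0_semigroup :: "(real \<Rightarrow> 'a::complex_banach \<Rightarrow> 'a) \<Rightarrow> bool"
  where "c0_semigroup T \<longleftrightarrow>
    (\<forall>t\<ge>0. bounded_clinear (T t)) \<and>
    T 0 = id \<and>
    (\<forall>s\<ge>0. \<forall>t\<ge>0. T (s + t) = T s \<circ> T t) \<and>
    (\<forall>x. ((\<lambda>t. T t x) \<longlongrightarrow> x) (at_right 0))"

definition is_generator ::
    "(real \<Rightarrow> 'a::complex_banach \<Rightarrow> 'a) \<Rightarrow> 'a set \<Rightarrow> ('a \<Rightarrow> 'a) \<Rightarrow> bool"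
  where "is_generator T D G \<longleftrightarrow>
    D = {x. \<exists>y. ((\<lambda>h. (T h x - x) /\<^sub>R h) \<longlongrightarrow> y) (at_right 0)} \<and>
    (\<forall>x\<in>D. ((\<lambda>h. (T h x - x) /\<^sub>R h) \<longlongrightarrow> G x) (at_right 0))"

definition exponentially_stable :: "(real \<Rightarrow> 'a::complex_banach \<Rightarrow> 'a) \<Rightarrow> bool"
  where "exponentially_stable T \<longleftrightarrow>
    (\<exists>M \<omega>. M \<ge> 1 \<and> \<omega> > 0 \<and> (\<forall>t\<ge>0. onorm (T t) \<le> M * exp (- \<omega> * t)))"

definition sector :: "real \<Rightarrow> complex set"
  where "sector \<theta> = {z. z \<noteq> 0 \<and> \<bar>Arg z\<bar> < \<theta>}"

text \<open>Complex differentiability, in operator norm, of an operator-valued function on an open set.\<close>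

definition op_holomorphic_on ::
    "(complex \<Rightarrow> 'a::complex_banach \<Rightarrow> 'a) \<Rightarrow> complex set \<Rightarrow> bool"
  where "op_holomorphic_on S U \<longleftrightarrow>
    (\<forall>z\<in>U. \<exists>L. bounded_clinear L \<and>
      ((\<lambda>w. onorm (\<lambda>x. inverse (w - z) *\<^sub>C (S w x - S z x) - L x)) \<longlongrightarrow> 0) (at z within U))"

text \<open>
  A strongly continuous semigroup is analytic if it extends to a holomorphic semigroup on some
  open sector around the positive half-line which is strongly continuous at \<open>0\<close> on every smaller
  sector. No boundedness on the sector is required.
\<close>

definition analytic_semigroup :: "(real \<Rightarrow> 'a::complex_banach \<Rightarrow> 'a) \<Rightarrow> bool"
  where "analytic_semigroup T \<longleftrightarrow> c0_semigroup T \<and>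
    (\<exists>\<theta> S. 0 < \<theta> \<and> \<theta> \<le> pi / 2 \<and>
      (\<forall>t\<ge>0. S (complex_of_real t) = T t) \<and>
      (\<forall>z\<in>sector \<theta>. bounded_clinear (S z)) \<and>
      (\<forall>z\<in>sector \<theta>. \<forall>w\<in>sector \<theta>. S (z + w) = S z \<circ> S w) \<and>
      op_holomorphic_on S (sector \<theta>) \<and>
      (\<forall>\<theta>'. 0 < \<theta>' \<and> \<theta>' < \<theta> \<longrightarrow> (\<forall>x. ((\<lambda>z. S z x) \<longlongrightarrow> x) (at 0 within sector \<theta>'))))"

text \<open>
  The operator \<open>(\<mu> + A)\<^sup>-\<^sup>1\<close>. It is the genuine inverse when \<open>\<mu> + A\<close> maps \<open>D\<close> bijectively onto the
  whole space, which holds for \<open>Re \<mu> > 0\<close> if \<open>-A\<close> generates an exponentially stable semigroup.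
\<close>

definition shifted_inverse ::
    "'a::complex_banach set \<Rightarrow> ('a \<Rightarrow> 'a) \<Rightarrow> complex \<Rightarrow> 'a \<Rightarrow> 'a"
  where "shifted_inverse D A \<mu> = inv_into D (\<lambda>x. \<mu> *\<^sub>C x + A x)"

definition weiss_condition ::
    "'a::complex_banach set \<Rightarrow> ('a \<Rightarrow> 'a) \<Rightarrow> ('a \<Rightarrow> 'b::complex_banach) \<Rightarrow> bool"
  where "weiss_condition D A C \<longleftrightarrow>
    (\<forall>\<mu>. Re \<mu> > 0 \<longrightarrow> bounded_clinear (\<lambda>x. sqrt (Re \<mu>) *\<^sub>R C (shifted_inverse D A \<mu> x))) \<and>
    bdd_above ((\<lambda>\<mu>. onorm (\<lambda>x. sqrt (Re \<mu>) *\<^sub>R C (shifted_inverse D A \<mu> x))) ` {\<mu>. Re \<mu> > 0})"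

definition distribution_function :: "'w measure \<Rightarrow> ('w \<Rightarrow> 'b::real_normed_vector) \<Rightarrow> real \<Rightarrow> ennreal"
  where "distribution_function M f \<alpha> = emeasure M {\<omega> \<in> space M. norm (f \<omega>) > \<alpha>}"

definition ennreal_sqrt :: "ennreal \<Rightarrow> ennreal"
  where "ennreal_sqrt d = (if d = \<infinity> then \<infinity> else ennreal (sqrt (enn2real d)))"

definition weak_L2_norm :: "'w measure \<Rightarrow> ('w \<Rightarrow> 'b::real_normed_vector) \<Rightarrow> ennreal"
  where "weak_L2_norm M f = (SUP \<alpha>\<in>{0<..}. ennreal \<alpha> * ennreal_sqrt (distribution_function M f \<alpha>))"

definition weak_L2 :: "'w measure \<Rightarrow> ('w \<Rightarrow> 'b::real_normed_vector) set"
  where "weak_L2 M = {f \<in> borel_measurable M. weak_L2_norm M f < \<infinity>}"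

text \<open>
  Continuity is taken with respect to the quasi-norm of \<open>L\<^sup>2\<^sup>,\<^sup>\<infinity>(\<real>\<^sub>+; Y)\<close>. The value \<open>C (T 0 x) = C x\<close>,
  meaningless for \<open>x\<close> outside the domain, only matters on a null set.
\<close>

definition weak_L2_admissible ::
    "(real \<Rightarrow> 'a::complex_banach \<Rightarrow> 'a) \<Rightarrow> ('a \<Rightarrow> 'b::complex_banach) \<Rightarrow> bool"
  where "weak_L2_admissible T C \<longleftrightarrow>
    (\<forall>x. (\<lambda>t. C (T t x)) \<in> weak_L2 (lebesgue_on {0..})) \<and>
    (\<forall>x. ((\<lambda>y. weak_L2_norm (lebesgue_on {0..}) (\<lambda>t. C (T t y) - C (T t x))) \<longlongrightarrow> 0) (at x))"

end

theory Submission
  imports Defs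
begin

text \<open>
  All three conditions are compared with the parabolic bound (b).

  For (a) \<open>\<Longrightarrow>\<close> (b) write \<open>C T(t) = C (\<lambda> + A)\<^sup>-\<^sup>1 (\<lambda> + A) T(t)\<close> with \<open>\<lambda> = 1 / t\<close> and use the bound
  \<open>\<parallel>A T(t)\<parallel> \<le> c / t\<close>, which Cauchy's estimate gives for an analytic semigroup. Conversely, with
  \<open>B = C (\<lambda> + A)\<^sup>-\<^sup>1\<close> the function \<open>f(t) = B e\<^sup>-\<^sup>\<lambda>\<^sup>t T(t) x\<close> runs from \<open>B x\<close> to \<open>0\<close> and has derivative
  \<open>- e\<^sup>-\<^sup>\<lambda>\<^sup>t C T(t) x\<close>; integrating the bound (b) separately on both sides of \<open>t = 1 / Re \<lambda>\<close> gives (a).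

  (b) \<open>\<Longrightarrow>\<close> (c) is immediate because \<open>t\<^sup>-\<^sup>1\<^sup>/\<^sup>2\<close> lies in weak \<open>L\<^sup>2\<close>. For (c) \<open>\<Longrightarrow>\<close> (b), the weak bound yields some
  \<open>s \<in> [(1 - \<eta>) t, t]\<close> at which \<open>\<parallel>C T(s) x\<parallel> \<le> K t\<^sup>-\<^sup>1\<^sup>/\<^sup>2 \<parallel>x\<parallel>\<close>, and \<open>T(t) x - T(s) x = T(t / 2) y\<close> with
  \<open>\<parallel>y\<parallel> \<le> \<parallel>x\<parallel> / 3\<close> by analyticity if \<open>\<eta>\<close> is small. Iterating this with \<open>t / 2\<close>, \<open>t / 4\<close>, \<open>\<dots>\<close> in place of \<open>t\<close>
  converges, because the crude bound \<open>\<parallel>C T(t)\<parallel> \<le> a / t\<close> at most doubles in each step.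
\<close>

section \<open>Calculus in complex Banach spaces\<close>

lemma scaleC_one [simp]: "1 *\<^sub>C (x::'a::complex_banach) = x"
  using scaleC_of_real[of 1 x] by simp

lemma scaleC_scaleR: "a *\<^sub>C (r *\<^sub>R x) = r *\<^sub>R (a *\<^sub>C (x::'a::complex_banach))"
  by (metis mult.commute scaleC_of_real scaleC_scaleC)

lemma bounded_bilinear_scaleC: "bounded_bilinear (scaleC :: complex \<Rightarrow> 'a::complex_banach \<Rightarrow> 'a)"
proof
  fix r :: real and a :: complex and x :: 'a
  show "(r *\<^sub>R a) *\<^sub>C x = r *\<^sub>R (a *\<^sub>C x)"
    by (metis scaleC_of_real scaleC_scaleC scaleR_conv_of_real)
  show "\<exists>K. \<forall>a (x::'a). norm (a *\<^sub>C x) \<le> norm a * norm x * K"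
    by (intro exI[of _ 1]) (simp add: norm_scaleC)
qed (simp_all add: scaleC_add_left scaleC_add_right scaleC_scaleR)

lemmas continuous_on_scaleC [continuous_intros] =
    bounded_bilinear.continuous_on[OF bounded_bilinear_scaleC]
  and tendsto_scaleC [tendsto_intros] = bounded_bilinear.tendsto[OF bounded_bilinear_scaleC]
  and has_derivative_scaleC = bounded_bilinear.FDERIV[OF bounded_bilinear_scaleC]
  and scaleC_diff_right = bounded_bilinear.diff_right[OF bounded_bilinear_scaleC]
  and scaleC_diff_left = bounded_bilinear.diff_left[OF bounded_bilinear_scaleC]
  and scaleC_minus_right = bounded_bilinear.minus_right[OF bounded_bilinear_scaleC]
  and scaleC_minus_left = bounded_bilinear.minus_left[OF bounded_bilinear_scaleC]
  and scaleC_scaleR_left = bounded_bilinear.scaleR_left[OF bounded_bilinear_scaleC]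
  and scaleC_zero_right [simp] = bounded_bilinear.zero_right[OF bounded_bilinear_scaleC]
  and scaleC_zero_left [simp] = bounded_bilinear.zero_left[OF bounded_bilinear_scaleC]
  and bounded_linear_scaleC_right = bounded_bilinear.bounded_linear_right[OF bounded_bilinear_scaleC]
  and bounded_linear_scaleC_left = bounded_bilinear.bounded_linear_left[OF bounded_bilinear_scaleC]

lemma bounded_linear_imp_norm_bound:
  assumes "bounded_linear f"
  obtains K where "K \<ge> 0" "\<And>x. norm (f x) \<le> K * norm x"
  by (metis assms bounded_linear.nonneg_bounded mult.commute)

section \<open>Baire category and uniform boundedness\<close>

lemma Baire_union:
  fixes E :: "nat \<Rightarrow> 'a::banach set"
  assumes "\<And>n. closed (E n)" "(\<Union>n. E n) = UNIV"
  obtains n where "interior (E n) \<noteq> {}"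
proof -
  have "euclidean interior_of \<Union>(range E) = {}" if "\<And>n. interior (E n) = {}"
    by (rule Baire_category_alt)
      (use that assms completely_metrizable_space_euclidean in auto)
  with assms(2) that show ?thesis
    by (metis empty_not_UNIV interior_of_topspace topspace_euclidean)
qed

text \<open>
  The shrinking index sets \<open>I n\<close> express boundedness of the family along a filter with a
  countable base, here the filter of points of a sector that tend to \<open>0\<close>.
\<close>

lemma uniform_boundedness:
  fixes S :: "'i \<Rightarrow> 'a::banach \<Rightarrow> 'b::real_normed_vector" and I :: "nat \<Rightarrow> 'i set"
  assumes lin: "\<And>n i. i \<in> I n \<Longrightarrow> bounded_linear (S i)"
    and ptw: "\<And>x. \<exists>n. \<forall>i\<in>I n. norm (S i x) \<le> real n"
  obtains n K where "K \<ge> 0" "\<And>i x. i \<in> I n \<Longrightarrow> norm (S i x) \<le> K * norm x"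
proof -
  define E where "E n = (\<Inter>i\<in>I n. {x. norm (S i x) \<le> real n})" for n
  have "closed (E n)" for n
    unfolding E_def
    by (intro closed_INT ballI closed_Collect_le continuous_intros
        bounded_linear.continuous_on[OF lin])
  moreover have "(\<Union>n. E n) = UNIV"
    using ptw by (auto simp: E_def)
  ultimately obtain n where "interior (E n) \<noteq> {}"
    by (rule Baire_union)
  then obtain a e where e: "e > 0" "cball a e \<subseteq> E n"
    by (metis equals0I mem_interior_cball)
  have "norm (S i x) \<le> 2 * real n / e * norm x" if i: "i \<in> I n" for i x
  proof (cases "x = 0")
    case True
    then show ?thesis
      using lin[OF i] by (simp add: linear_simps)
  next
    case False
    interpret bounded_linear "S i"
      by (rule lin[OF i])
    \<comment> \<open>Rescaling \<open>x\<close> to length \<open>e\<close> puts both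
      \<open>a + y\<close> and \<open>a\<close> into \<open>E n\<close>; subtracting the two bounds
      gives the factor 2.\<close>
    define y where "y = (e / norm x) *\<^sub>R x"
    have "norm y = e"
      using False e by (simp add: y_def)
    then have "a + y \<in> E n" "a \<in> E n"
      using e by (auto simp: subset_iff dist_norm)
    then have "norm (S i (a + y)) \<le> real n" "norm (S i a) \<le> real n"
      using i by (auto simp: E_def)
    then have "norm (S i y) \<le> 2 * real n"
      using norm_triangle_ineq4[of "S i (a + y)" "S i a"] by (simp add: add)
    moreover have "norm (S i y) = e / norm x * norm (S i x)"
      using e by (simp add: y_def scaleR)
    ultimately show ?thesis
      using False e by (simp add: field_simps)
  qed
  then show ?thesis
    using that[of "2 * real n / e" n] e by simp
qed

section \<open>Vector-valued holomorphic functions of one variable\<close>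

text \<open>
  The circle means have derivative \<open>0\<close> in the radius, since the radial derivative is a multiple
  of the angular one, whose integral over a period vanishes.
\<close>

lemma mean_value_property:
  fixes k k' :: "complex \<Rightarrow> 'a::complex_banach"
  assumes cont: "continuous_on (ball 0 \<rho>) k"
    and deriv: "\<And>z. z \<in> ball 0 \<rho> - {0} \<Longrightarrow> (k has_derivative (\<lambda>h. h *\<^sub>C k' z)) (at z)"
    and cont': "continuous_on (ball 0 \<rho> - {0}) k'"
    and r: "0 \<le> r" "r < \<rho>"
  shows "integral {0..2 * pi} (\<lambda>\<phi>. k (of_real r * cis \<phi>)) = (2 * pi) *\<^sub>R k 0"
proof -
  define J where "J s = integral (cbox 0 (2 * pi)) (\<lambda>\<phi>. k (of_real s * cis \<phi>))" for s :: real
  have J_cont: "continuous_on {0..r} J"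
    unfolding J_def
    by (rule integral_continuous_on_param)
      (use r in \<open>auto simp: split_beta norm_mult intro!: continuous_intros continuous_on_compose2[OF cont]\<close>)
  have J_deriv: "(J has_vector_derivative 0) (at s)" if s: "s \<in> {0<..<r}" for s
  proof -
    have mem: "of_real s * cis \<phi> \<in> ball 0 \<rho> - {0}" if "s \<in> {0<..<r}" for s \<phi>
      using that r by (simp add: norm_mult)
    have angular: "((\<lambda>\<phi>. k (of_real s * cis \<phi>)) has_vector_derivative
        (of_real s * \<i>) *\<^sub>C (cis \<phi> *\<^sub>C k' (of_real s * cis \<phi>))) (at \<phi> within U)" for \<phi> U
    proof -
      have "((\<lambda>\<phi>. of_real s * cis \<phi>) has_derivative (\<lambda>h. of_real s * (h *\<^sub>R (\<i> * cis \<phi>)))) (at \<phi> within U)"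
        by (intro has_derivative_mult_right has_derivative_cis has_derivative_ident)
      from has_derivative_compose[OF this deriv[OF mem[OF s]]]
      show ?thesis
        by (simp add: has_vector_derivative_def scaleC_scaleC scaleC_scaleR_left mult_ac)
    qed
    have "((\<lambda>\<phi>. (of_real s * \<i>) *\<^sub>C (cis \<phi> *\<^sub>C k' (of_real s * cis \<phi>))) has_integral
        k (of_real s * cis (2 * pi)) - k (of_real s * cis 0)) {0..2 * pi}"
      by (rule fundamental_theorem_of_calculus) (use angular in auto)
    \<comment> \<open>Dividing the vanishing angular integral by \<open>of_real s * \<i>\<close>
      turns its integrand into the radial derivative.\<close>
    from has_integral_linear[OF this bounded_linear_scaleC_right[of "inverse (of_real s * \<i>)"]]
    have "((\<lambda>\<phi>. inverse (of_real s * \<i>) *\<^sub>C (of_real s * \<i>) *\<^sub>C (cis \<phi> *\<^sub>C k' (of_real s * cis \<phi>))) has_integral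
        0) {0..2 * pi}"
      unfolding o_def by simp
    moreover have "inverse (of_real s * \<i>) *\<^sub>C (of_real s * \<i>) *\<^sub>C y = y" for y :: 'a
    proof -
      have "inverse (of_real s * \<i>) * (of_real s * \<i>) = 1"
        by (rule left_inverse) (use s in auto)
      then show ?thesis
        by (metis scaleC_one scaleC_scaleC)
    qed
    ultimately have "integral (cbox 0 (2 * pi)) (\<lambda>\<phi>. cis \<phi> *\<^sub>C k' (of_real s * cis \<phi>)) = 0"
      by (simp add: integral_unique)
    moreover have "(J has_vector_derivative
        integral (cbox 0 (2 * pi)) (\<lambda>\<phi>. cis \<phi> *\<^sub>C k' (of_real s * cis \<phi>))) (at s within {0<..<r})"
      unfolding J_def
    proof (rule leibniz_rule_vector_derivative[OF _ _ _ s])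
      fix s \<phi> :: real assume s: "s \<in> {0<..<r}"
      have "((\<lambda>s. of_real s * cis \<phi>) has_derivative (\<lambda>h. of_real h * cis \<phi>)) (at s within {0<..<r})"
        by (intro has_derivative_mult_left has_derivative_of_real has_derivative_ident)
      from has_derivative_compose[OF this deriv[OF mem[OF s]]]
      show "((\<lambda>s. k (of_real s * cis \<phi>)) has_vector_derivative cis \<phi> *\<^sub>C k' (of_real s * cis \<phi>))
          (at s within {0<..<r})"
        by (simp add: has_vector_derivative_def flip: scaleC_scaleC) (simp add: scaleC_of_real)
    next
      fix s :: real assume s: "s \<in> {0<..<r}"
      show "(\<lambda>\<phi>. k (of_real s * cis \<phi>)) integrable_on cbox 0 (2 * pi)"
        by (intro integrable_continuous continuous_on_compose2[OF cont] continuous_intros)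
          (use mem[OF s] in auto)
    next
      show "continuous_on ({0<..<r} \<times> cbox 0 (2 * pi)) (\<lambda>(s, \<phi>). cis \<phi> *\<^sub>C k' (of_real s * cis \<phi>))"
        unfolding split_beta
        by (intro continuous_intros continuous_on_compose2[OF cont'] subsetI)
          (use mem in auto)
    qed auto
    ultimately show ?thesis
      using s by (simp add: at_within_open[of s "{0<..<r}"])
  qed
  have "J r = J 0"
  proof (cases "r = 0")
    case False
    have "norm (J r - J 0) \<le> 0 - 0"
      by (rule differentiable_bound_general[where \<phi>="\<lambda>_. 0" and \<phi>'="\<lambda>_. 0" and f'="\<lambda>_. 0"])
        (use False r J_cont J_deriv in auto)
    then show ?thesis
      by simp
  qed auto
  then show ?thesis
    by (simp add: J_def)
qed

text \<open>The difference quotient \<open>k\<close> of \<open>f\<close> at \<open>a\<close>,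
  extended by \<open>f' a\<close> at 0, has the mean value property. On the circle of radius
  \<open>r\<close> its norm is at most \<open>2 * B / r\<close>, hence so is the norm of its value
  at the centre. The factor 2 comes from subtracting \<open>f a\<close>.\<close>

lemma Cauchy_estimate:
  fixes f f' :: "complex \<Rightarrow> 'a::complex_banach"
  assumes deriv: "\<And>z. z \<in> ball a \<rho> \<Longrightarrow> (f has_derivative (\<lambda>h. h *\<^sub>C f' z)) (at z)"
    and cont': "continuous_on (ball a \<rho>) f'"
    and bound: "\<And>z. z \<in> ball a \<rho> \<Longrightarrow> norm (f z) \<le> B"
    and r: "0 < r" "r < \<rho>"
  shows "norm (f' a) \<le> 2 * B / r"
proof -
  define k where "k z = (if z = 0 then f' a else inverse z *\<^sub>C (f (a + z) - f a))" for z
  define k' where "k' z = inverse z *\<^sub>C f' (a + z) - inverse (z\<^sup>2) *\<^sub>C (f (a + z) - f a)" for z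
  have shift: "((\<lambda>z. f (a + z)) has_derivative (\<lambda>h. h *\<^sub>C f' (a + z))) (at z)"
    if "z \<in> ball 0 \<rho>" for z
  proof -
    have "((\<lambda>z. a + z) has_derivative (\<lambda>h. h)) (at z)"
      by (auto intro!: derivative_eq_intros)
    from has_derivative_compose[OF this deriv[of "a + z"]] show ?thesis
      using that by (simp add: dist_norm)
  qed
  have shift_cont: "continuous_on (ball 0 \<rho>) (\<lambda>z. f (a + z))"
    by (intro continuous_at_imp_continuous_on ballI has_derivative_continuous[OF shift])
  have shift_cont': "continuous_on (ball 0 \<rho>) (\<lambda>z. f' (a + z))"
    by (intro continuous_on_compose2[OF cont'] continuous_intros) (auto simp: dist_norm)
  have kd: "(k has_derivative (\<lambda>h. h *\<^sub>C k' z)) (at z)" if z: "z \<in> ball 0 \<rho> - {0}" for z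
  proof -
    have "(inverse has_derivative (\<lambda>h. - (inverse z * h * inverse z))) (at z)"
      using z by (auto intro!: derivative_eq_intros)
    from has_derivative_scaleC[OF this has_derivative_diff[OF shift has_derivative_const]] z
    have "((\<lambda>z. inverse z *\<^sub>C (f (a + z) - f a)) has_derivative
      (\<lambda>h. inverse z *\<^sub>C (h *\<^sub>C f' (a + z) - 0) + (- (inverse z * h * inverse z)) *\<^sub>C (f (a + z) - f a))) (at z)"
      by blast
    moreover have "inverse z *\<^sub>C (h *\<^sub>C f' (a + z) - 0) + (- (inverse z * h * inverse z)) *\<^sub>C (f (a + z) - f a)
        = h *\<^sub>C k' z" for h
      by (simp add: k'_def scaleC_diff_right scaleC_scaleC scaleC_minus_left power2_eq_square mult_ac)
    ultimately have "((\<lambda>z. inverse z *\<^sub>C (f (a + z) - f a)) has_derivative (\<lambda>h. h *\<^sub>C k' z)) (at z)"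
      by simp
    then show ?thesis
      by (rule has_derivative_transform_within_open[of _ _ _ _ "- {0}"]) (use z in \<open>auto simp: k_def\<close>)
  qed
  have "isCont k z" if z: "z \<in> ball 0 \<rho>" for z
  proof (cases "z = 0")
    case False
    then show ?thesis
      using kd z has_derivative_continuous by blast
  next
    case True
    \<comment> \<open>Continuity of \<open>k\<close> at 0 restates the differentiability of
      \<open>f\<close> at \<open>a\<close>.\<close>
    have lim: "((\<lambda>h. norm (f (a + h) - f a - h *\<^sub>C f' a) / norm h) \<longlongrightarrow> 0) (at 0)"
      using deriv[of a] r unfolding has_derivative_at by simp
    have eq: "norm (f (a + h) - f a - h *\<^sub>C f' a) / norm h = norm (k h - f' a)" if "h \<noteq> 0" for h
    proof -
      have "k h - f' a = inverse h *\<^sub>C (f (a + h) - f a - h *\<^sub>C f' a)"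
        using that by (simp add: k_def scaleC_diff_right scaleC_scaleC)
      then show ?thesis
        by (simp add: norm_scaleC norm_inverse divide_inverse)
    qed
    have "eventually (\<lambda>h. norm (f (a + h) - f a - h *\<^sub>C f' a) / norm h = norm (k h - f' a)) (at 0)"
      using eq by (auto simp: eventually_at_filter)
    with lim have "((\<lambda>h. norm (k h - f' a)) \<longlongrightarrow> 0) (at 0)"
      by (rule Lim_transform_eventually)
    then have "((\<lambda>h. k h - k 0) \<longlongrightarrow> 0) (at 0)"
      by (simp add: k_def tendsto_norm_zero_iff)
    then show ?thesis
      unfolding True isCont_def by (rule LIM_zero_cancel)
  qed
  then have k_cont: "continuous_on (ball 0 \<rho>) k"
    by (simp add: continuous_at_imp_continuous_on)
  have k'_cont: "continuous_on (ball 0 \<rho> - {0}) k'"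
    unfolding k'_def
    by (intro continuous_intros continuous_on_subset[OF shift_cont] continuous_on_subset[OF shift_cont']) auto
  have "integral {0..2 * pi} (\<lambda>\<phi>. k (of_real r * cis \<phi>)) = (2 * pi) *\<^sub>R k 0"
    by (rule mean_value_property[OF k_cont kd k'_cont]) (use r in auto)
  moreover have "norm (integral {0..2 * pi} (\<lambda>\<phi>. k (of_real r * cis \<phi>))) \<le> 2 * B / r * (2 * pi - 0)"
  proof (rule integral_bound)
    show "continuous_on {0..2 * pi} (\<lambda>\<phi>. k (of_real r * cis \<phi>))"
      by (intro continuous_on_compose2[OF k_cont] continuous_intros) (use r in \<open>auto simp: norm_mult\<close>)
    fix \<phi> :: real
    define z where "z = of_real r * cis \<phi>"
    have z: "norm z = r"
      using r by (simp add: z_def norm_mult)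
    have "norm (f (a + z) - f a) \<le> B + B"
      using r z by (intro norm_triangle_le_diff add_mono bound) (auto simp: dist_norm)
    then show "norm (k (of_real r * cis \<phi>)) \<le> 2 * B / r"
      using r z unfolding z_def[symmetric]
      by (auto simp: k_def norm_scaleC norm_inverse norm_divide divide_simps)
  qed auto
  ultimately have "2 * pi * norm (k 0) \<le> 2 * pi * (2 * B / r)"
    by (simp add: mult_ac)
  then have "norm (k 0) \<le> 2 * B / r"
    by (rule mult_left_le_imp_le) simp
  then show ?thesis
    by (simp add: k_def)
qed

section \<open>Exponentially stable semigroups and their resolvents\<close>

lemma tendsto_at_right_cong:
  assumes "(f \<longlongrightarrow> l) (at_right (0::real))" "\<And>h. 0 < h \<Longrightarrow> f h = g h"
  shows "(g \<longlongrightarrow> l) (at_right 0)"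
  by (rule Lim_transform_eventually[OF assms(1) eventually_mono[OF eventually_at_right_less]])
    (rule assms(2))

text \<open>Links derivatives to the difference quotients by which \<open>is_generator\<close>
  describes the generator.\<close>

lemma has_vector_derivative_iff_quotient:
  "(f has_vector_derivative y) (at x within S) \<longleftrightarrow>
    ((\<lambda>s. (f s - f x) /\<^sub>R (s - x)) \<longlongrightarrow> y) (at x within S)"
proof -
  have "norm (f s - f x - (s - x) *\<^sub>R y) / norm (s - x) = norm ((f s - f x) /\<^sub>R (s - x) - y)"
    if "s \<noteq> x" for s
  proof -
    have "(f s - f x) /\<^sub>R (s - x) - y = (f s - f x - (s - x) *\<^sub>R y) /\<^sub>R (s - x)"
      using that by (simp add: scaleR_diff_right)
    then show ?thesis
      by (simp add: divide_inverse mult.commute)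
  qed
  then have "((\<lambda>s. norm (f s - f x - (s - x) *\<^sub>R y) / norm (s - x)) \<longlongrightarrow> 0) (at x within S) \<longleftrightarrow>
      ((\<lambda>s. norm ((f s - f x) /\<^sub>R (s - x) - y)) \<longlongrightarrow> 0) (at x within S)"
    by (intro tendsto_cong) (auto simp: eventually_at_filter)
  then show ?thesis
    unfolding has_vector_derivative_def has_derivative_iff_norm tendsto_norm_zero_iff
    by (simp add: bounded_linear_scaleR_left LIM_zero_iff)
qed

locale stable_semigroup =
  fixes T :: "real \<Rightarrow> 'a::complex_banach \<Rightarrow> 'a" and D :: "'a set" and A :: "'a \<Rightarrow> 'a"
  assumes semigroup: "c0_semigroup T"
    and stable: "exponentially_stable T"
    and generator: "is_generator T D (\<lambda>x. - A x)"
begin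

lemma bounded_linear_T: "t \<ge> 0 \<Longrightarrow> bounded_linear (T t)"
  and T_scaleC: "t \<ge> 0 \<Longrightarrow> T t (c *\<^sub>C x) = c *\<^sub>C T t x"
  and T_0 [simp]: "T 0 x = x"
  and T_add: "s \<ge> 0 \<Longrightarrow> t \<ge> 0 \<Longrightarrow> T (s + t) x = T s (T t x)"
  and T_tendsto_0: "((\<lambda>t. T t x) \<longlongrightarrow> x) (at_right 0)"
  using semigroup by (auto simp: c0_semigroup_def bounded_clinear_def)

lemmas linear_T = linear_simps[OF bounded_linear_T]

lemma T_commute: "s \<ge> 0 \<Longrightarrow> t \<ge> 0 \<Longrightarrow> T s (T t x) = T t (T s x)"
  by (metis T_add add.commute)

lemma T_bound:
  obtains M \<omega> where "M \<ge> 1" "\<omega> > 0" "\<And>t x. t \<ge> 0 \<Longrightarrow> norm (T t x) \<le> M * exp (- \<omega> * t) * norm x"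
proof -
  obtain M \<omega> where M: "M \<ge> 1" "\<omega> > 0" "\<And>t. t \<ge> 0 \<Longrightarrow> onorm (T t) \<le> M * exp (- \<omega> * t)"
    using stable unfolding exponentially_stable_def by blast
  have "norm (T t x) \<le> M * exp (- \<omega> * t) * norm x" if "t \<ge> 0" for t x
    by (rule order_trans[OF onorm[OF bounded_linear_T[OF that]]])
      (use M(3)[OF that] in \<open>auto intro: mult_right_mono\<close>)
  with M that show ?thesis by blast
qed

lemma T_uniform_bound:
  obtains M where "M \<ge> 1" "\<And>t x. t \<ge> 0 \<Longrightarrow> norm (T t x) \<le> M * norm x"
proof -
  obtain M \<omega> where M: "M \<ge> 1" "\<omega> > 0" "\<And>t x. t \<ge> 0 \<Longrightarrow> norm (T t x) \<le> M * exp (- \<omega> * t) * norm x"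
    using T_bound by blast
  have "norm (T t x) \<le> M * norm x" if "t \<ge> 0" for t x
  proof (rule order_trans[OF M(3)[OF that]])
    have "exp (- \<omega> * t) \<le> 1"
      using that M by simp
    then show "M * exp (- \<omega> * t) * norm x \<le> M * norm x"
      using M by (intro mult_right_mono mult_left_le) auto
  qed
  with M that show ?thesis by blast
qed

text \<open>For \<open>s \<le> u\<close> the semigroup law gives
  \<open>T u x - T s x = T s (T (u - s) x - x)\<close>. Strong continuity at 0 and the uniform bound
  on \<open>T s\<close> therefore yield continuity from both sides.\<close>

lemma continuous_on_T: "continuous_on {0..} (\<lambda>t. T t x)"
  unfolding continuous_on_iff
proof (intro ballI allI impI)
  fix t e :: real assume t: "t \<in> {0..}" and e: "e > 0"
  obtain M where M: "M \<ge> 1" "\<And>t x. t \<ge> 0 \<Longrightarrow> norm (T t x) \<le> M * norm x"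
    using T_uniform_bound by blast
  obtain d where d: "d > 0" "\<And>h. 0 < h \<Longrightarrow> h < d \<Longrightarrow> norm (T h x - x) < e / M"
    using tendstoD[OF T_tendsto_0, of "e / M" x] e M
    by (auto simp: eventually_at_right_field dist_norm)
  have *: "norm (T u x - T s x) < e" if "0 \<le> s" "s \<le> u" "u - s < d" for s u
  proof (cases "s = u")
    case False
    have "T u x - T s x = T s (T (u - s) x - x)"
      using that T_add[of s "u - s" x] by (simp add: linear_T)
    also have "norm \<dots> \<le> M * norm (T (u - s) x - x)"
      using M that by blast
    also have "\<dots> < M * (e / M)"
      using M that d(2)[of "u - s"] False by (intro mult_strict_left_mono) auto
    finally show ?thesis using M by simp
  qed (use e in auto)
  show "\<exists>d>0. \<forall>s\<in>{0..}. dist s t < d \<longrightarrow> dist (T s x) (T t x) < e"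
  proof (intro exI[of _ d] conjI ballI impI)
    fix s assume "s \<in> {0..}" "dist s t < d"
    then show "dist (T s x) (T t x) < e"
      using t *[of s t] *[of t s] by (cases "s \<le> t") (auto simp: dist_norm norm_minus_commute)
  qed (rule d)
qed

lemma D_limit: "x \<in> D \<Longrightarrow> ((\<lambda>h. (T h x - x) /\<^sub>R h) \<longlongrightarrow> - A x) (at_right 0)"
  using generator unfolding is_generator_def by blast

lemma D_I:
  assumes "((\<lambda>h. (T h x - x) /\<^sub>R h) \<longlongrightarrow> y) (at_right 0)"
  shows "x \<in> D" "A x = - y"
proof -
  show "x \<in> D"
    using generator assms unfolding is_generator_def by blast
  from tendsto_unique[OF _ D_limit[OF this] assms] show "A x = - y"
    by (metis minus_minus trivial_limit_at_right_real)
qed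

lemma
  assumes "x \<in> D"
  shows D_scaleC: "c *\<^sub>C x \<in> D" and A_scaleC: "A (c *\<^sub>C x) = c *\<^sub>C A x"
proof -
  have "((\<lambda>h. (T h (c *\<^sub>C x) - c *\<^sub>C x) /\<^sub>R h) \<longlongrightarrow> c *\<^sub>C (- A x)) (at_right 0)"
    by (rule tendsto_at_right_cong[OF tendsto_scaleC[OF tendsto_const D_limit[OF assms]]])
      (simp add: T_scaleC scaleC_diff_right scaleC_scaleR)
  from D_I[OF this] show "c *\<^sub>C x \<in> D" "A (c *\<^sub>C x) = c *\<^sub>C A x"
    by (auto simp: scaleC_minus_right)
qed

text \<open>The bounded operator \<open>T t\<close> passes through the limit of the difference
  quotients and commutes with \<open>T h\<close>.\<close>

lemma T_D:
  assumes "x \<in> D" "t \<ge> 0"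
  shows "T t x \<in> D" "A (T t x) = T t (A x)"
proof -
  have "((\<lambda>h. T t ((T h x - x) /\<^sub>R h)) \<longlongrightarrow> T t (- A x)) (at_right 0)"
    by (rule bounded_linear.tendsto[OF bounded_linear_T D_limit, OF assms(2,1)])
  then have "((\<lambda>h. (T h (T t x) - T t x) /\<^sub>R h) \<longlongrightarrow> - T t (A x)) (at_right 0)"
    unfolding linear_T(4)[OF assms(2)]
    by (rule tendsto_at_right_cong) (use assms(2) in \<open>auto simp: linear_T T_commute\<close>)
  from D_I[OF this] show "T t x \<in> D" "A (T t x) = T t (A x)"
    by auto
qed

section \<open>Orbit integrals and the inverse of \<open>A\<close>\<close>

definition orbit_integral :: "real \<Rightarrow> 'a \<Rightarrow> 'a"
  where "orbit_integral t x = integral {0..t} (\<lambda>s. T s x)"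

lemma continuous_on_T_interval: "continuous_on {0..t} (\<lambda>s. T s x)"
  by (rule continuous_on_subset[OF continuous_on_T]) auto

lemma bounded_linear_orbit_integral:
  assumes "t \<ge> 0"
  shows "bounded_linear (orbit_integral t)"
proof -
  obtain M where M: "M \<ge> 1" "\<And>t x. t \<ge> 0 \<Longrightarrow> norm (T t x) \<le> M * norm x"
    using T_uniform_bound by blast
  have int: "(\<lambda>s. T s x) integrable_on {0..t}" for x
    by (intro integrable_continuous_real continuous_on_T_interval)
  show ?thesis
  proof (rule bounded_linear_intro)
    fix x y :: 'a and r :: real
    have "integral {0..t} (\<lambda>s. T s (x + y)) = integral {0..t} (\<lambda>s. T s x + T s y)"
      by (rule integral_cong) (simp add: linear_T)
    then show "orbit_integral t (x + y) = orbit_integral t x + orbit_integral t y"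
      by (simp add: orbit_integral_def integral_add int)
    have "integral {0..t} (\<lambda>s. T s (r *\<^sub>R x)) = integral {0..t} (\<lambda>s. r *\<^sub>R T s x)"
      by (rule integral_cong) (simp add: linear_T)
    then show "orbit_integral t (r *\<^sub>R x) = r *\<^sub>R orbit_integral t x"
      by (simp add: orbit_integral_def)
    have "norm (orbit_integral t x) \<le> M * norm x * (t - 0)"
      unfolding orbit_integral_def
      by (rule integral_bound) (use assms M continuous_on_T_interval in auto)
    then show "norm (orbit_integral t x) \<le> norm x * (M * t)"
      by (simp add: mult_ac)
  qed
qed

lemma T_orbit_integral:
  assumes "t \<ge> 0" "h \<ge> 0"
  shows "T h (orbit_integral t x) = orbit_integral (h + t) x - orbit_integral h x"
    and "T h (orbit_integral t x) = orbit_integral t (T h x)"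
proof -
  have "((\<lambda>s. T s x) has_integral orbit_integral t x) {0..t}"
    unfolding orbit_integral_def
    by (intro integrable_integral integrable_continuous_real continuous_on_T_interval)
  from has_integral_linear[OF this bounded_linear_T[OF assms(2)]]
  have int: "((\<lambda>s. T h (T s x)) has_integral T h (orbit_integral t x)) {0..t}"
    by (simp add: o_def)
  \<comment> \<open>The shift of variable is obtained from the primitive
    \<open>orbit_integral (h + s) x\<close> of \<open>T (h + s) x\<close>.\<close>
  have "((\<lambda>s. T (h + s) x) has_integral orbit_integral (h + t) x - orbit_integral (h + 0) x) {0..t}"
  proof (rule fundamental_theorem_of_calculus[OF assms(1)])
    fix s assume s: "s \<in> {0..t}"
    have "((\<lambda>u. orbit_integral u x) has_vector_derivative T (h + s) x) (at (h + s) within {0..h + t})"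
      unfolding orbit_integral_def
      by (rule integral_has_vector_derivative[OF continuous_on_T_interval]) (use s assms in auto)
    then have "((\<lambda>u. orbit_integral u x) has_vector_derivative T (h + s) x) (at (h + s) within (+) h ` {0..t})"
      by (rule has_vector_derivative_within_subset) (use assms in auto)
    moreover have "((\<lambda>s. h + s) has_vector_derivative 1) (at s within {0..t})"
      by (auto intro!: derivative_eq_intros)
    ultimately show "((\<lambda>s. orbit_integral (h + s) x) has_vector_derivative T (h + s) x) (at s within {0..t})"
      using vector_diff_chain_within[of "\<lambda>s. h + s" 1 s "{0..t}" "\<lambda>u. orbit_integral u x" "T (h + s) x"]
      by (simp add: o_def)
  qed
  then have "((\<lambda>s. T h (T s x)) has_integral orbit_integral (h + t) x - orbit_integral h x) {0..t}"
    unfolding add_0_right by (rule has_integral_eq[rotated]) (use assms in \<open>auto simp: T_add\<close>)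
  with int show "T h (orbit_integral t x) = orbit_integral (h + t) x - orbit_integral h x"
    by (rule has_integral_unique)
  have "((\<lambda>s. T s (T h x)) has_integral T h (orbit_integral t x)) {0..t}"
    by (rule has_integral_eq[OF _ int]) (use assms T_commute in auto)
  then show "T h (orbit_integral t x) = orbit_integral t (T h x)"
    by (simp add: orbit_integral_def integral_unique)
qed

lemma orbit_integral_average: "((\<lambda>h. orbit_integral h x /\<^sub>R h) \<longlongrightarrow> x) (at_right 0)"
proof -
  have "((\<lambda>u. orbit_integral u x) has_vector_derivative T 0 x) (at 0 within {0..1})"
    unfolding orbit_integral_def
    by (rule integral_has_vector_derivative[OF continuous_on_T_interval]) auto
  moreover have "orbit_integral 0 x = 0"
    by (simp add: orbit_integral_def)
  ultimately have "((\<lambda>h. orbit_integral h x /\<^sub>R h) \<longlongrightarrow> x) (at 0 within {0..1})"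
    by (simp add: has_vector_derivative_iff_quotient)
  then show ?thesis
    by (simp add: at_within_Icc_at_right)
qed

text \<open>
  The inverse of \<open>A\<close> is the integral of the semigroup over the half-line, written as a series of
  integrals over unit intervals.
\<close>

definition invA :: "'a \<Rightarrow> 'a"
  where "invA x = (\<Sum>n. T (real n) (orbit_integral 1 x))"

lemma summable_orbit:
  obtains K where "K \<ge> 0" "\<And>x. summable (\<lambda>n. T (real n) x)" "\<And>x. norm (\<Sum>n. T (real n) x) \<le> K * norm x"
proof -
  obtain M \<omega> where M: "M \<ge> 1" "\<omega> > 0" "\<And>t x. t \<ge> 0 \<Longrightarrow> norm (T t x) \<le> M * exp (- \<omega> * t) * norm x"
    using T_bound by blast
  \<comment> \<open>Exponential stability at integer times gives a geometric majorant with ratio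
    \<open>q\<close>.\<close>
  define q where "q = exp (- \<omega>)"
  have q: "0 \<le> q" "q < 1"
    using M by (auto simp: q_def)
  have bound: "norm (T (real n) x) \<le> M * norm x * q ^ n" for n x
    using M(3)[of "real n" x] by (simp add: q_def mult_ac flip: exp_of_nat_mult)
  have geo: "summable (\<lambda>n. M * norm x * q ^ n)" for x :: 'a
    using q by (intro summable_mult summable_geometric) auto
  have sum: "summable (\<lambda>n. norm (T (real n) x))" for x
    by (rule summable_comparison_test'[OF geo[of x], of 0]) (use bound in auto)
  have "norm (\<Sum>n. T (real n) x) \<le> M / (1 - q) * norm x" for x
  proof -
    have "norm (\<Sum>n. T (real n) x) \<le> (\<Sum>n. norm (T (real n) x))"
      by (rule summable_norm[OF sum])
    also have "\<dots> \<le> (\<Sum>n. M * norm x * q ^ n)"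
      by (rule suminf_le[OF bound sum geo])
    also have "\<dots> = M / (1 - q) * norm x"
      using q by (subst suminf_mult) (auto simp: suminf_geometric summable_geometric)
    finally show ?thesis .
  qed
  moreover have "M / (1 - q) \<ge> 0"
    using M q by simp
  ultimately show ?thesis
    using that[OF _ summable_norm_cancel[OF sum]] by blast
qed

lemma bounded_linear_invA: "bounded_linear invA"
proof -
  obtain K where K: "K \<ge> 0" "\<And>x. summable (\<lambda>n. T (real n) x)" "\<And>x. norm (\<Sum>n. T (real n) x) \<le> K * norm x"
    using summable_orbit by blast
  have "bounded_linear (\<lambda>x. \<Sum>n. T (real n) x)"
  proof (rule bounded_linear_intro)
    show "norm (\<Sum>n. T (real n) x) \<le> norm x * K" for x
      using K(3)[of x] by (simp add: mult_ac)
  qed (simp_all add: linear_T suminf_add[OF K(2) K(2), symmetric] suminf_scaleR_right[OF K(2), symmetric])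
  from bounded_linear_compose[OF this bounded_linear_orbit_integral[of 1]] show ?thesis
    by (simp add: invA_def[abs_def])
qed

text \<open>The partial sums of the series telescope to \<open>orbit_integral (real n) x\<close>.
  Splitting \<open>orbit_integral (h + real n) x\<close> in two ways shows that \<open>T h\<close>
  changes them by \<open>T (real n) (orbit_integral h x) - orbit_integral h x\<close>, whose first
  term tends to 0.\<close>

lemma T_invA:
  assumes "h \<ge> 0"
  shows "T h (invA x) = invA (T h x)" and "T h (invA x) = invA x - orbit_integral h x"
proof -
  have K: "\<And>x. summable (\<lambda>n. T (real n) x)"
    using summable_orbit by blast
  show "T h (invA x) = invA (T h x)"
    unfolding invA_def bounded_linear.suminf[OF bounded_linear_T[OF assms] K]
    using assms by (simp add: T_orbit_integral(2)[symmetric] T_commute)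
  have partial: "(\<Sum>k<n. T (real k) (orbit_integral 1 x)) = orbit_integral (real n) x" for n
  proof (induction n)
    case (Suc n)
    then show ?case
      using T_orbit_integral(1)[of 1 "real n" x] by (simp add: add.commute)
  qed (simp add: orbit_integral_def)
  have lim: "(\<lambda>n. orbit_integral (real n) x) \<longlonglongrightarrow> invA x"
    using summable_LIMSEQ[OF K, of "orbit_integral 1 x"] unfolding partial invA_def .
  have "(\<lambda>n. T h (orbit_integral (real n) x)) \<longlonglongrightarrow> T h (invA x)"
    by (rule bounded_linear.tendsto[OF bounded_linear_T[OF assms] lim])
  moreover have "(\<lambda>n. T h (orbit_integral (real n) x)) \<longlonglongrightarrow> invA x + 0 - orbit_integral h x"
  proof -
    have "T h (orbit_integral (real n) x)
        = orbit_integral (real n) x + T (real n) (orbit_integral h x) - orbit_integral h x" for n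
      using T_orbit_integral(1)[OF _ assms, of "real n" x] T_orbit_integral(1)[OF assms, of "real n" x]
      by (simp add: add.commute)
    then show ?thesis
      by (simp only:) (intro tendsto_intros lim summable_LIMSEQ_zero[OF K])
  qed
  ultimately show "T h (invA x) = invA x - orbit_integral h x"
    using LIMSEQ_unique by fastforce
qed

text \<open>The difference quotient of \<open>invA x\<close> is minus the average of the orbit over
  \<open>{0..h}\<close>, which tends to \<open>- x\<close>.\<close>

lemma invA_right: "invA x \<in> D" "A (invA x) = x"
proof -
  have "((\<lambda>h. - (orbit_integral h x /\<^sub>R h)) \<longlongrightarrow> - x) (at_right 0)"
    by (intro tendsto_minus orbit_integral_average)
  then have "((\<lambda>h. (T h (invA x) - invA x) /\<^sub>R h) \<longlongrightarrow> - x) (at_right 0)"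
    by (rule tendsto_at_right_cong)
      (simp add: T_invA(2))
  from D_I[OF this] show "invA x \<in> D" "A (invA x) = x"
    by auto
qed

text \<open>Since \<open>invA\<close> is bounded and commutes with \<open>T h\<close>, it passes
  through the difference quotient of \<open>x\<close>. The limit shows
  \<open>invA (A x) = A (invA x)\<close>, and the right inverse property applies.\<close>

lemma invA_left:
  assumes "x \<in> D"
  shows "invA (A x) = x"
proof -
  interpret invA: bounded_linear invA by (rule bounded_linear_invA)
  have "((\<lambda>h. invA ((T h x - x) /\<^sub>R h)) \<longlongrightarrow> invA (- A x)) (at_right 0)"
    by (intro invA.tendsto D_limit assms)
  then have "((\<lambda>h. (T h (invA x) - invA x) /\<^sub>R h) \<longlongrightarrow> - invA (A x)) (at_right 0)"
    unfolding linear_simps(4)[OF bounded_linear_invA]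
    by (rule tendsto_at_right_cong)
      (simp add: invA.scaleR invA.diff T_invA(1))
  from D_I(2)[OF this] show ?thesis
    by (simp add: invA_right)
qed

section \<open>Resolvents as inverses for rescaled semigroups\<close>

lemma rescaled_stable_semigroup:
  assumes "Re \<mu> \<ge> 0"
  shows "stable_semigroup (\<lambda>t x. exp (- \<mu> * of_real t) *\<^sub>C T t x) D (\<lambda>x. \<mu> *\<^sub>C x + A x)"
proof
  let ?e = "\<lambda>t. exp (- \<mu> * of_real t)"
  have exp_lim: "((\<lambda>t. exp (\<nu> * of_real t)) \<longlongrightarrow> 1) (at_right 0)" for \<nu> :: complex
    by (auto intro!: tendsto_eq_intros)
  show "c0_semigroup (\<lambda>t x. ?e t *\<^sub>C T t x)"
    unfolding c0_semigroup_def bounded_clinear_def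
  proof (intro conjI allI impI)
    fix t :: real assume "t \<ge> 0"
    then show "bounded_linear (\<lambda>x. ?e t *\<^sub>C T t x)"
      by (intro bounded_linear_compose[OF bounded_linear_scaleC_right bounded_linear_T])
    show "?e t *\<^sub>C T t (c *\<^sub>C x) = c *\<^sub>C ?e t *\<^sub>C T t x" for c x
      using \<open>t \<ge> 0\<close> by (simp add: T_scaleC scaleC_scaleC mult.commute)
  next
    fix s t :: real assume "s \<ge> 0" "t \<ge> 0"
    then show "(\<lambda>x. ?e (s + t) *\<^sub>C T (s + t) x) = (\<lambda>x. ?e s *\<^sub>C T s x) \<circ> (\<lambda>x. ?e t *\<^sub>C T t x)"
      by (simp add: fun_eq_iff T_add T_scaleC scaleC_scaleC distrib_left exp_diff exp_minus exp_add field_simps)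
  next
    show "((\<lambda>t. ?e t *\<^sub>C T t x) \<longlongrightarrow> x) (at_right 0)" for x
      using tendsto_scaleC[OF exp_lim[of "- \<mu>"] T_tendsto_0[of x]] by simp
  qed (simp add: id_def)
  show "exponentially_stable (\<lambda>t x. ?e t *\<^sub>C T t x)"
  proof -
    obtain M \<omega> where M: "M \<ge> 1" "\<omega> > 0" "\<And>t x. t \<ge> 0 \<Longrightarrow> norm (T t x) \<le> M * exp (- \<omega> * t) * norm x"
      using T_bound by blast
    have "onorm (\<lambda>x. ?e t *\<^sub>C T t x) \<le> M * exp (- \<omega> * t)" if "t \<ge> 0" for t
    proof (rule onorm_bound)
      fix x
      have "cmod (?e t) \<le> 1"
        using assms that by simp
      then have "cmod (?e t) * norm (T t x) \<le> norm (T t x)"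
        by (simp add: mult_left_le_one_le)
      with M(3)[OF that, of x] show "norm (?e t *\<^sub>C T t x) \<le> M * exp (- \<omega> * t) * norm x"
        by (simp add: norm_scaleC)
    qed (use M in auto)
    with M show ?thesis
      unfolding exponentially_stable_def by blast
  qed
  \<comment> \<open>A product rule for difference quotients at 0. Taken with \<open>- \<mu>\<close>
    it computes the new generator; taken with \<open>\<mu>\<close> it undoes the rescaling, so the
    domain does not grow.\<close>
  have rescale: "((\<lambda>h. (exp (\<nu> * of_real h) *\<^sub>C U h - x) /\<^sub>R h) \<longlongrightarrow> y + \<nu> *\<^sub>C x) (at_right 0)"
    if U: "((\<lambda>h. (U h - x) /\<^sub>R h) \<longlongrightarrow> y) (at_right 0)" for U \<nu> x and y :: 'a
  proof -
    have "((\<lambda>z. exp (\<nu> * z)) has_field_derivative \<nu>) (at (of_real 0))"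
      by (auto intro!: derivative_eq_intros)
    from has_vector_derivative_real_field[OF this]
    have "((\<lambda>h. exp (\<nu> * of_real h)) has_vector_derivative \<nu>) (at 0 within {0<..})" .
    then have "((\<lambda>h. (exp (\<nu> * of_real h) - 1) /\<^sub>R h) \<longlongrightarrow> \<nu>) (at_right 0)"
      by (simp add: has_vector_derivative_iff_quotient)
    then have "((\<lambda>h. exp (\<nu> * of_real h) *\<^sub>C ((U h - x) /\<^sub>R h) + ((exp (\<nu> * of_real h) - 1) /\<^sub>R h) *\<^sub>C x)
        \<longlongrightarrow> 1 *\<^sub>C y + \<nu> *\<^sub>C x) (at_right 0)"
      by (intro tendsto_intros U exp_lim)
    moreover have "exp (\<nu> * of_real h) *\<^sub>C ((U h - x) /\<^sub>R h) + ((exp (\<nu> * of_real h) - 1) /\<^sub>R h) *\<^sub>C x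
        = (exp (\<nu> * of_real h) *\<^sub>C U h - x) /\<^sub>R h" for h
      by (simp add: scaleC_scaleR scaleC_scaleR_left scaleC_diff_right scaleC_diff_left algebra_simps)
    ultimately show ?thesis by simp
  qed
  have forth: "((\<lambda>h. (?e h *\<^sub>C T h x - x) /\<^sub>R h) \<longlongrightarrow> - (\<mu> *\<^sub>C x + A x)) (at_right 0)" if "x \<in> D" for x
    using rescale[OF D_limit[OF that], of "- \<mu>"] by (simp add: scaleC_minus_left algebra_simps)
  have converse: "x \<in> D" if "((\<lambda>h. (?e h *\<^sub>C T h x - x) /\<^sub>R h) \<longlongrightarrow> y) (at_right 0)" for x y
  proof -
    have "exp (\<mu> * of_real h) *\<^sub>C ?e h *\<^sub>C T h x = T h x" for h
      by (simp add: scaleC_scaleC flip: exp_add)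
    with rescale[OF that, of \<mu>] show ?thesis
      by (auto intro: D_I(1))
  qed
  show "is_generator (\<lambda>t x. ?e t *\<^sub>C T t x) D (\<lambda>x. - (\<mu> *\<^sub>C x + A x))"
    unfolding is_generator_def using forth converse by blast
qed

text \<open>The inverse \<open>invA\<close> of the rescaled semigroup inverts
  \<open>\<mu> + A\<close> on both sides, so the choice in \<open>inv_into\<close> is forced. The
  case \<open>\<mu> = 0\<close> is included because the inverse of \<open>A\<close> itself is used
  below.\<close>

lemma
  assumes "Re \<mu> \<ge> 0"
  shows bounded_clinear_resolvent: "bounded_clinear (shifted_inverse D A \<mu>)"
    and resolvent_D: "shifted_inverse D A \<mu> x \<in> D"
    and resolvent_right: "\<mu> *\<^sub>C shifted_inverse D A \<mu> x + A (shifted_inverse D A \<mu> x) = x"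
    and resolvent_left: "x \<in> D \<Longrightarrow> shifted_inverse D A \<mu> (\<mu> *\<^sub>C x + A x) = x"
proof -
  interpret U: stable_semigroup "\<lambda>t x. exp (- \<mu> * of_real t) *\<^sub>C T t x" D "\<lambda>x. \<mu> *\<^sub>C x + A x"
    by (rule rescaled_stable_semigroup[OF assms])
  have inj: "inj_on (\<lambda>x. \<mu> *\<^sub>C x + A x) D"
    by (rule inj_on_inverseI[of _ U.invA]) (rule U.invA_left)
  have R: "shifted_inverse D A \<mu> x = U.invA x" for x
    unfolding shifted_inverse_def by (rule inv_into_f_eq[OF inj U.invA_right])
  show "x \<in> D \<Longrightarrow> shifted_inverse D A \<mu> (\<mu> *\<^sub>C x + A x) = x"
    unfolding R by (rule U.invA_left)
  show "shifted_inverse D A \<mu> x \<in> D"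
    unfolding R by (rule U.invA_right)
  show "\<mu> *\<^sub>C shifted_inverse D A \<mu> x + A (shifted_inverse D A \<mu> x) = x"
    unfolding R by (rule U.invA_right)
  \<comment> \<open>Complex homogeneity follows by applying the left inverse property to
    \<open>c *\<^sub>C U.invA x\<close>.\<close>
  have "U.invA (c *\<^sub>C x) = c *\<^sub>C U.invA x" for c x
    using U.invA_left[OF U.D_scaleC[OF U.invA_right(1)], of c x]
    by (simp only: U.A_scaleC[OF U.invA_right(1)] U.invA_right(2))
  then show "bounded_clinear (shifted_inverse D A \<mu>)"
    unfolding bounded_clinear_def R[abs_def] using U.bounded_linear_invA by blast
qed

end

section \<open>Analytic semigroups\<close>

text \<open>The bound by \<open>pi\<close> excludes the negative axis, where \<open>Arg\<close>
  takes the value \<open>pi\<close>. On the slit plane \<open>Arg\<close> is continuous and the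
  sector is a preimage of an open interval.\<close>

lemma open_sector:
  assumes "\<theta> \<le> pi"
  shows "open (sector \<theta>)"
proof -
  have "sector \<theta> = (- \<real>\<^sub>\<le>\<^sub>0) \<inter> Arg -` {-\<theta><..<\<theta>}"
  proof (intro set_eqI iffI)
    fix z assume z: "z \<in> sector \<theta>"
    then have "Arg z \<noteq> pi"
      using assms by (auto simp: sector_def)
    with z show "z \<in> (- \<real>\<^sub>\<le>\<^sub>0) \<inter> Arg -` {-\<theta><..<\<theta>}"
      by (auto simp: sector_def Arg_eq_pi complex_nonpos_Reals_iff complex_eq_iff)
  qed (auto simp: sector_def)
  moreover have "open ((- \<real>\<^sub>\<le>\<^sub>0 :: complex set) \<inter> Arg -` {-\<theta><..<\<theta>})"
    by (intro continuous_open_preimage continuous_at_imp_continuous_on ballI continuous_at_Arg) auto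
  ultimately show ?thesis by simp
qed

lemma of_real_in_sector: "\<theta> > 0 \<Longrightarrow> t > 0 \<Longrightarrow> of_real t \<in> sector \<theta>"
  by (simp add: sector_def Arg_of_real)

text \<open>A sector is a cone, so the radius can be proportional to \<open>t\<close>. With the
  chosen \<open>\<kappa>\<close>, a point \<open>z\<close> of the ball has
  \<open>Re z > t / 2\<close> and \<open>\<bar>Im z\<bar> < \<theta> * (t / 2)\<close>; its argument
  is then small by \<open>\<bar>arctan u\<bar> \<le> \<bar>u\<bar>\<close>.\<close>

lemma ball_subset_sector:
  assumes "\<theta> > 0"
  obtains \<kappa> where "0 < \<kappa>" "\<kappa> \<le> 1 / 2" "\<And>t. t > 0 \<Longrightarrow> ball (of_real t) (\<kappa> * t) \<subseteq> sector \<theta>"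
proof -
  define \<kappa> where "\<kappa> = min (1 / 2) (\<theta> / 2)"
  have "z \<in> sector \<theta>" if t: "t > 0" and z: "z \<in> ball (of_real t) (\<kappa> * t)" for t z
  proof -
    have "\<bar>Re (of_real t - z)\<bar> < \<kappa> * t" "\<bar>Im (of_real t - z)\<bar> < \<kappa> * t"
      using z abs_Re_le_cmod[of "of_real t - z"] abs_Im_le_cmod[of "of_real t - z"]
      by (auto simp: dist_norm)
    moreover have "\<kappa> * t \<le> t / 2" "\<kappa> * t \<le> \<theta> * (t / 2)"
      using t by (auto simp: \<kappa>_def min_def field_simps)
    ultimately have Re: "Re z > t / 2" and Im: "\<bar>Im z\<bar> < \<theta> * (t / 2)"
      by auto
    have "\<bar>arctan (Im z / Re z)\<bar> \<le> \<bar>Im z / Re z\<bar>"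
      by (rule abs_arctan_le)
    also have "\<dots> < \<theta>"
    proof -
      have "\<theta> * (t / 2) < \<theta> * Re z"
        using Re assms by (intro mult_strict_left_mono)
      then show ?thesis
        using Im Re t by (simp add: abs_divide divide_simps)
    qed
    finally show ?thesis
      using Re t arg_conv_arctan[of z] by (auto simp: sector_def)
  qed
  moreover have "0 < \<kappa>" "\<kappa> \<le> 1 / 2"
    using assms by (auto simp: \<kappa>_def)
  ultimately show ?thesis
    using that by blast
qed

text \<open>Passes from convergence in operator norm to derivatives of orbits: the remainder at
  \<open>x\<close> is at most the operator norm of the remainder times \<open>norm x\<close>. One
  operator \<open>S' z\<close> serves all \<open>x\<close>.\<close>

lemma op_holomorphic_on_imp_has_derivative:
  assumes hol: "op_holomorphic_on S U" and "open U" and lin: "\<And>z. z \<in> U \<Longrightarrow> bounded_clinear (S z)"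
  obtains S' where "\<And>z. z \<in> U \<Longrightarrow> bounded_linear (S' z)"
    "\<And>z x. z \<in> U \<Longrightarrow> ((\<lambda>w. S w x) has_derivative (\<lambda>h. h *\<^sub>C S' z x)) (at z)"
proof -
  have "\<exists>L. bounded_linear L \<and> (\<forall>x. ((\<lambda>w. S w x) has_derivative (\<lambda>h. h *\<^sub>C L x)) (at z))" if z: "z \<in> U" for z
  proof -
    obtain L where L: "bounded_linear L"
      and lim: "((\<lambda>w. onorm (\<lambda>x. inverse (w - z) *\<^sub>C (S w x - S z x) - L x)) \<longlongrightarrow> 0) (at z)"
      using hol z at_within_open[OF z \<open>open U\<close>]
      unfolding op_holomorphic_on_def bounded_clinear_def by fastforce
    have "((\<lambda>w. S w x) has_derivative (\<lambda>h. h *\<^sub>C L x)) (at z)" for x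
    proof -
      have "((\<lambda>w. norm (S w x - S z x - (w - z) *\<^sub>C L x) / norm (w - z)) \<longlongrightarrow> 0) (at z)"
      proof (rule Lim_null_comparison)
        show "((\<lambda>w. onorm (\<lambda>x. inverse (w - z) *\<^sub>C (S w x - S z x) - L x) * norm x) \<longlongrightarrow> 0) (at z)"
          using tendsto_mult_left_zero[OF lim] .
        have "norm (S w x - S z x - (w - z) *\<^sub>C L x) / norm (w - z)
            \<le> onorm (\<lambda>x. inverse (w - z) *\<^sub>C (S w x - S z x) - L x) * norm x"
          if w: "w \<in> U" "w \<noteq> z" for w
        proof -
          have "bounded_linear (\<lambda>x. inverse (w - z) *\<^sub>C (S w x - S z x) - L x)"
            using lin[OF z] lin[OF w(1)] L unfolding bounded_clinear_def
            by (intro bounded_linear_sub bounded_linear_compose[OF bounded_linear_scaleC_right]) auto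
          from onorm[OF this, of x]
          have "norm (inverse (w - z) *\<^sub>C (S w x - S z x) - L x)
            \<le> onorm (\<lambda>x. inverse (w - z) *\<^sub>C (S w x - S z x) - L x) * norm x" .
          moreover have "inverse (w - z) *\<^sub>C (S w x - S z x) - L x
              = inverse (w - z) *\<^sub>C (S w x - S z x - (w - z) *\<^sub>C L x)"
            using w by (simp add: scaleC_diff_right scaleC_scaleC)
          ultimately show ?thesis
            by (simp add: norm_scaleC norm_inverse divide_inverse mult.commute)
        qed
        then show "\<forall>\<^sub>F w in at z. norm (norm (S w x - S z x - (w - z) *\<^sub>C L x) / norm (w - z))
            \<le> onorm (\<lambda>x. inverse (w - z) *\<^sub>C (S w x - S z x) - L x) * norm x"
          using z \<open>open U\<close> by (auto simp: eventually_at_topological)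
      qed
      then show ?thesis
        by (simp add: has_derivative_iff_norm bounded_linear_scaleC_left)
    qed
    with L show ?thesis by blast
  qed
  then show ?thesis
    using that by metis
qed

section \<open>Smoothing and the estimate of \<open>A T(t)\<close> for analytic semigroups\<close>

locale stable_analytic_semigroup = stable_semigroup +
  assumes analytic: "analytic_semigroup T"
begin

text \<open>All three claims rest on the derivative \<open>S'\<close> of the holomorphic extension:
  on the positive axis it equals \<open>- A (T t x)\<close>, and Cauchy's estimate on a ball of
  radius comparable to \<open>t\<close> bounds it for small \<open>t\<close>. Exponential decay
  handles large \<open>t\<close>.\<close>

lemma
  shows T_in_D: "t > 0 \<Longrightarrow> T t x \<in> D"
    and T_has_vector_derivative: "t > 0 \<Longrightarrow> ((\<lambda>s. T s x) has_vector_derivative - A (T t x)) (at t)"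
    and A_T_bound: "\<exists>c\<ge>0. \<forall>t>0. \<forall>x. norm (A (T t x)) \<le> c / t * norm x"
proof -
  obtain \<theta> S where \<theta>: "0 < \<theta>" "\<theta> \<le> pi / 2"
    and S_T: "\<And>t. t \<ge> 0 \<Longrightarrow> S (of_real t) = T t"
    and S_lin: "\<And>z. z \<in> sector \<theta> \<Longrightarrow> bounded_clinear (S z)"
    and S_add: "\<And>z w. z \<in> sector \<theta> \<Longrightarrow> w \<in> sector \<theta> \<Longrightarrow> S (z + w) = S z \<circ> S w"
    and S_hol: "op_holomorphic_on S (sector \<theta>)"
    and S_lim: "\<And>\<theta>' x. 0 < \<theta>' \<Longrightarrow> \<theta>' < \<theta> \<Longrightarrow> ((\<lambda>z. S z x) \<longlongrightarrow> x) (at 0 within sector \<theta>')"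
    using analytic unfolding analytic_semigroup_def by blast
  have op: "open (sector \<theta>)"
    using \<theta> by (intro open_sector) auto
  obtain S' where S'_lin: "\<And>z. z \<in> sector \<theta> \<Longrightarrow> bounded_linear (S' z)"
    and S': "\<And>z x. z \<in> sector \<theta> \<Longrightarrow> ((\<lambda>w. S w x) has_derivative (\<lambda>h. h *\<^sub>C S' z x)) (at z)"
    using op_holomorphic_on_imp_has_derivative[OF S_hol op S_lin] by blast
  have S_cont: "isCont (\<lambda>w. S w x) z" if "z \<in> sector \<theta>" for x z
    using has_derivative_continuous[OF S'[OF that]] .

  \<comment> \<open>Differentiate the identity \<open>S v x = S (v - w) (S w x)\<close> in
    \<open>v\<close>.\<close>
  have S'_add: "S' (z + w) x = S' z (S w x)" if z: "z \<in> sector \<theta>" and w: "w \<in> sector \<theta>" and zw: "z + w \<in> sector \<theta>" for z w x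
  proof -
    have "((\<lambda>v. v - w) has_derivative (\<lambda>h. h)) (at (z + w))"
      by (auto intro!: derivative_eq_intros)
    from has_derivative_compose[OF this, of "\<lambda>v. S v (S w x)"] S'[OF z, of "S w x"]
    have "((\<lambda>v. S (v - w) (S w x)) has_derivative (\<lambda>h. h *\<^sub>C S' z (S w x))) (at (z + w))"
      by simp
    moreover have "open ((\<lambda>v. v - w) -` sector \<theta>)"
      by (rule open_vimage[OF op]) (intro continuous_intros)
    ultimately have "((\<lambda>v. S v x) has_derivative (\<lambda>h. h *\<^sub>C S' z (S w x))) (at (z + w))"
    proof (rule has_derivative_transform_within_open)
      show "z + w \<in> (\<lambda>v. v - w) -` sector \<theta>"
        using z by simp
      show "S (v - w) (S w x) = S v x" if "v \<in> (\<lambda>v. v - w) -` sector \<theta>" for v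
        using S_add[of "v - w" w] that w by simp
    qed
    from has_derivative_unique[OF S'[OF zw] this] show ?thesis
      by (metis scaleC_one)
  qed
  \<comment> \<open>\<open>Cauchy_estimate\<close> asks for a continuous derivative. For a fixed
    small \<open>s\<close>, \<open>S' w x\<close> is the bounded operator
    \<open>S' (of_real s)\<close> applied to \<open>S (w - of_real s) x\<close>, which is continuous
    in \<open>w\<close>.\<close>
  have S'_cont: "isCont (\<lambda>w. S' w x) z" if z: "z \<in> sector \<theta>" for x z
  proof -
    have "((\<lambda>s. z - of_real s) \<longlongrightarrow> z - of_real 0) (at_right 0)"
      by (intro tendsto_intros)
    then have "eventually (\<lambda>s. z - of_real s \<in> sector \<theta>) (at_right 0)"
      using op z by (intro topological_tendstoD) auto
    then have "eventually (\<lambda>s. 0 < s \<and> z - of_real s \<in> sector \<theta>) (at_right 0)"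
      by (intro eventually_conj eventually_at_right_less)
    then obtain s :: real where s: "s > 0" "z - of_real s \<in> sector \<theta>"
      using eventually_happens'[OF trivial_limit_at_right_real] by blast
    have "open ((\<lambda>w. w - of_real s) -` sector \<theta> \<inter> sector \<theta>)"
      by (intro open_Int op open_vimage continuous_intros)
    then have "eventually (\<lambda>w. w \<in> (\<lambda>w. w - of_real s) -` sector \<theta> \<inter> sector \<theta>) (nhds z)"
      using s z by (intro eventually_nhds_in_open) auto
    then have "eventually (\<lambda>w. S' (of_real s) (S (w - of_real s) x) = S' w x) (nhds z)"
    proof (rule eventually_mono)
      show "S' (of_real s) (S (w - of_real s) x) = S' w x"
        if "w \<in> (\<lambda>w. w - of_real s) -` sector \<theta> \<inter> sector \<theta>" for w
        using that S'_add[of "of_real s" "w - of_real s"] of_real_in_sector[OF \<theta>(1) s(1)] by simp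
    qed
    moreover have "isCont (\<lambda>w. S' (of_real s) (S (w - of_real s) x)) z"
    proof (rule bounded_linear.isCont[OF S'_lin[OF of_real_in_sector[OF \<theta>(1) s(1)]]])
      show "isCont (\<lambda>w. S (w - of_real s) x) z"
        by (rule isCont_o2[where f="\<lambda>w. w - of_real s" and g="\<lambda>w. S w x"])
          (use S_cont[OF s(2)] in \<open>auto intro!: continuous_intros\<close>)
    qed
    ultimately show ?thesis
      using isCont_cong by fast
  qed

  have deriv: "((\<lambda>s. T s x) has_vector_derivative S' (of_real t) x) (at t)" if t: "t > 0" for t x
  proof -
    have "(of_real has_derivative (\<lambda>h. of_real h)) (at t)"
      by (intro has_derivative_of_real has_derivative_ident)
    from has_derivative_compose[OF this S'[OF of_real_in_sector[OF \<theta>(1) t]]]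
    have "((\<lambda>s. S (of_real s) x) has_vector_derivative S' (of_real t) x) (at t)"
      by (simp add: has_vector_derivative_def scaleC_of_real)
    then show ?thesis
      by (rule has_vector_derivative_transform_within_open[of _ _ _ "{0<..}"]) (use t S_T in auto)
  qed
  have T_quot: "((\<lambda>h. (T h (T t x) - T t x) /\<^sub>R h) \<longlongrightarrow> S' (of_real t) x) (at_right 0)" if t: "t > 0" for t x
  proof -
    have "((\<lambda>s. (T s x - T t x) /\<^sub>R (s - t)) \<longlongrightarrow> S' (of_real t) x) (at_right t)"
      using deriv[OF t] unfolding has_vector_derivative_iff_quotient by (rule tendsto_mono[rotated]) (simp add: at_le)
    then have "((\<lambda>h. (T (h + t) x - T t x) /\<^sub>R h) \<longlongrightarrow> S' (of_real t) x) (at_right 0)"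
      by (simp add: filterlim_at_right_to_0[of _ _ t])
    then show ?thesis
      by (rule tendsto_at_right_cong) (use t in \<open>simp add: T_add\<close>)
  qed
  note in_D = D_I(1)[OF T_quot] and A_T = D_I(2)[OF T_quot]
  show "t > 0 \<Longrightarrow> T t x \<in> D"
    by (rule in_D)
  show "t > 0 \<Longrightarrow> ((\<lambda>s. T s x) has_vector_derivative - A (T t x)) (at t)"
    using deriv A_T by simp

  \<comment> \<open>Half the angle, since strong continuity at 0 is available only on strictly
    smaller sectors.\<close>
  obtain \<kappa> where \<kappa>: "0 < \<kappa>" "\<kappa> \<le> 1 / 2" "\<And>t. t > 0 \<Longrightarrow> ball (of_real t) (\<kappa> * t) \<subseteq> sector (\<theta> / 2)"
    using ball_subset_sector[of "\<theta> / 2"] \<theta> by auto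
  have sub: "sector (\<theta> / 2) \<subseteq> sector \<theta>"
    using \<theta> by (auto simp: sector_def)
  define I where "I n = {z \<in> sector (\<theta> / 2). norm z < 1 / real (Suc n)}" for n
  obtain n K where K: "K \<ge> 0" "\<And>z x. z \<in> I n \<Longrightarrow> norm (S z x) \<le> K * norm x"
  proof (rule uniform_boundedness[of I S])
    show "bounded_linear (S z)" if "z \<in> I n" for z n
      using that sub S_lin by (auto simp: I_def bounded_clinear_def)
    fix x
    obtain d where d: "d > 0"
      "\<And>z. z \<in> sector (\<theta> / 2) \<Longrightarrow> z \<noteq> 0 \<Longrightarrow> norm z < d \<Longrightarrow> norm (S z x - x) < 1"
      using tendstoD[OF S_lim[of "\<theta> / 2" x], of 1] \<theta> by (auto simp: eventually_at dist_norm)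
    \<comment> \<open>This \<open>n\<close> bounds the values at \<open>x\<close> and also makes the
      radius of \<open>I n\<close> smaller than \<open>d\<close>.\<close>
    obtain n where n: "real n \<ge> max (norm x + 1) (1 / d)"
      using real_arch_simple by blast
    have "norm (S z x) \<le> real n" if z: "z \<in> I n" for z
    proof -
      have "1 / real (Suc n) < d"
        using n d by (simp add: field_simps)
      then have "norm (S z x - x) < 1"
        using z by (intro d) (auto simp: I_def sector_def)
      then show ?thesis
        using n norm_triangle_sub[of "S z x" x] by simp
    qed
    then show "\<exists>n. \<forall>z\<in>I n. norm (S z x) \<le> real n"
      by blast
  qed blast
  \<comment> \<open>For \<open>t \<le> t\<^sub>0\<close> the ball of radius
    \<open>\<kappa> * t\<close> around \<open>t\<close> stays in norm below \<open>2 * t\<close>,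
    hence inside \<open>I n\<close>.\<close>
  define t\<^sub>0 where "t\<^sub>0 = 1 / (2 * real (Suc n))"
  have t0: "t\<^sub>0 > 0"
    by (simp add: t\<^sub>0_def)
  \<comment> \<open>This is the constant of Cauchy's estimate on the radius
    \<open>\<kappa> * t / 2\<close>.\<close>
  define c where "c = 4 * K / \<kappa>"
  have c: "c \<ge> 0"
    using K \<kappa> by (simp add: c_def)
  have small: "norm (A (T t x)) \<le> c / t * norm x" if t: "0 < t" "t \<le> t\<^sub>0" for t x
  proof -
    have sec: "ball (of_real t) (\<kappa> * t) \<subseteq> sector \<theta>"
      using \<kappa>(3)[OF t(1)] sub by blast
    have "norm (S' (of_real t) x) \<le> 2 * (K * norm x) / (\<kappa> * t / 2)"
    proof (rule Cauchy_estimate)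
      show "((\<lambda>w. S w x) has_derivative (\<lambda>h. h *\<^sub>C S' z x)) (at z)" if "z \<in> ball (of_real t) (\<kappa> * t)" for z
        using that sec S' by blast
      show "continuous_on (ball (of_real t) (\<kappa> * t)) (\<lambda>z. S' z x)"
        using sec S'_cont by (intro continuous_at_imp_continuous_on) blast
      show "norm (S z x) \<le> K * norm x" if z: "z \<in> ball (of_real t) (\<kappa> * t)" for z
      proof (rule K(2))
        have "\<kappa> * t \<le> t / 2"
          using \<kappa> t by simp
        moreover have "norm z \<le> t + norm (z - of_real t)"
          using norm_triangle_sub[of z "of_real t"] t by simp
        moreover have "norm (z - of_real t) < \<kappa> * t"
          using z by (simp add: dist_norm norm_minus_commute)
        ultimately have "norm z < 2 * t"
          using t by linarith
        also have "\<dots> \<le> 1 / real (Suc n)"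
          using t by (simp add: t\<^sub>0_def field_simps)
        finally show "z \<in> I n"
          using z \<kappa>(3)[OF t(1)] by (auto simp: I_def)
      qed
    qed (use \<kappa> t in auto)
    then show ?thesis
      using A_T[OF t(1)] t \<kappa> by (simp add: c_def field_simps)
  qed
  obtain M \<omega> where M: "M \<ge> 1" "\<omega> > 0" "\<And>t x. t \<ge> 0 \<Longrightarrow> norm (T t x) \<le> M * exp (- \<omega> * t) * norm x"
    using T_bound by blast
  \<comment> \<open>The summand \<open>c\<close> covers \<open>t \<le> t\<^sub>0\<close>. The other
    one covers \<open>t = s + t\<^sub>0\<close>, where \<open>T s\<close> decays and
    \<open>t * exp (- \<omega> * s) \<le> 1 / \<omega> + t\<^sub>0\<close>.\<close>
  define c' where "c' = c + M * (1 / \<omega> + t\<^sub>0) * (c / t\<^sub>0)"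
  have "norm (A (T t x)) \<le> c' / t * norm x" if t: "t > 0" for t x
  proof (cases "t \<le> t\<^sub>0")
    case True
    have "c \<le> c'"
      using c M t0 by (simp add: c'_def)
    then have "c / t * norm x \<le> c' / t * norm x"
      using t by (intro mult_right_mono divide_right_mono) auto
    with small[OF t True, of x] show ?thesis by linarith
  next
    case False
    define s where "s = t - t\<^sub>0"
    have s: "s > 0" "t = s + t\<^sub>0"
      using False by (auto simp: s_def)
    have "\<omega> * s \<le> exp (\<omega> * s)"
      using exp_ge_add_one_self[of "\<omega> * s"] by linarith
    then have "\<omega> * s * exp (- \<omega> * s) \<le> exp (\<omega> * s) * exp (- \<omega> * s)"
      by (rule mult_right_mono) simp
    then have "s * exp (- \<omega> * s) \<le> 1 / \<omega>"
      using M by (simp add: field_simps flip: exp_add)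
    moreover have "t\<^sub>0 * exp (- \<omega> * s) \<le> t\<^sub>0"
      using M s t0 by (intro mult_left_le) auto
    ultimately have e: "t * exp (- \<omega> * s) \<le> 1 / \<omega> + t\<^sub>0"
      unfolding s(2) distrib_right by linarith
    have "A (T t x) = T s (A (T t\<^sub>0 x))"
      using s t0 by (simp add: T_add T_D in_D)
    then have "norm (A (T t x)) \<le> M * exp (- \<omega> * s) * norm (A (T t\<^sub>0 x))"
      using M(3)[of s "A (T t\<^sub>0 x)"] s by simp
    also have "\<dots> \<le> M * exp (- \<omega> * s) * (c / t\<^sub>0 * norm x)"
      using small[OF t0 order_refl, of x] M by (intro mult_left_mono) auto
    finally have "t * norm (A (T t x)) \<le> t * (M * exp (- \<omega> * s) * (c / t\<^sub>0 * norm x))"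
      using t by (intro mult_left_mono) auto
    also have "\<dots> = (t * exp (- \<omega> * s)) * (M * (c / t\<^sub>0) * norm x)"
      by (simp add: mult_ac)
    also have "\<dots> \<le> (1 / \<omega> + t\<^sub>0) * (M * (c / t\<^sub>0) * norm x)"
      using e M c t0 by (intro mult_right_mono) auto
    also have "\<dots> = (c' - c) * norm x"
      by (simp add: c'_def mult_ac)
    also have "\<dots> \<le> c' * norm x"
      using c by (intro mult_right_mono) auto
    finally show ?thesis
      using t by (simp add: field_simps)
  qed
  moreover have "c' \<ge> 0"
    using c M t0 by (simp add: c'_def)
  ultimately show "\<exists>c\<ge>0. \<forall>t>0. \<forall>x. norm (A (T t x)) \<le> c / t * norm x"
    by blast
qed

end

section \<open>The weak Lebesgue space\<close>

lemma ennreal_sqrt_mono: "d \<le> e \<Longrightarrow> ennreal_sqrt d \<le> ennreal_sqrt e"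
  by (auto simp: ennreal_sqrt_def top.extremum_unique intro!: ennreal_leI enn2real_mono simp: less_top)

lemma ennreal_sqrt_ennreal: "r \<ge> 0 \<Longrightarrow> ennreal_sqrt (ennreal r) = ennreal (sqrt r)"
  by (simp add: ennreal_sqrt_def)

text \<open>The value at 0 may be arbitrary: it adds at most one point to the open part of a
  preimage.\<close>

lemma borel_measurable_lebesgue_on_continuous:
  fixes f :: "real \<Rightarrow> 'a::topological_space"
  assumes "continuous_on {0<..} f"
  shows "f \<in> borel_measurable (lebesgue_on {0..})"
proof (rule borel_measurableI)
  fix V :: "'a set" assume "open V"
  then have "open ({0<..} \<inter> f -` V)"
    by (intro continuous_open_preimage[OF assms]) auto
  then have "({0<..} \<inter> f -` V) \<union> (f -` V \<inter> {0}) \<in> sets lebesgue"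
    by (intro sets.Un) (auto intro: lebesgue_openin simp: Int_insert_right)
  moreover have "f -` V \<inter> {0..} = ({0<..} \<inter> f -` V) \<union> (f -` V \<inter> {0})"
    by auto
  ultimately show "f -` V \<inter> space (lebesgue_on {0..}) \<in> sets (lebesgue_on {0..})"
    by (subst sets_restrict_space_iff) auto
qed

lemma emeasure_lebesgue_on_Icc:
  fixes a b :: real
  assumes "0 \<le> a" "a \<le> b"
  shows "emeasure (lebesgue_on {0..}) {a..b} = ennreal (b - a)"
  using assms by (subst emeasure_restrict_space) auto

text \<open>The set where \<open>norm (f t) > \<alpha>\<close> lies in
  \<open>{0..(N / \<alpha>)\<^sup>2}\<close>, whatever \<open>f 0\<close> is, and the square root of
  its measure is at most \<open>N / \<alpha>\<close>.\<close>

lemma weak_L2_norm_le: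
  assumes "N \<ge> 0" and bound: "\<And>t. t > 0 \<Longrightarrow> norm (f t) \<le> N / sqrt t"
  shows "weak_L2_norm (lebesgue_on {0..}) f \<le> ennreal N"
  unfolding weak_L2_norm_def
proof (rule SUP_least)
  fix \<alpha> :: real assume "\<alpha> \<in> {0<..}"
  then have \<alpha>: "\<alpha> > 0" by simp
  have "{t \<in> space (lebesgue_on {0..}). norm (f t) > \<alpha>} \<subseteq> {0..(N / \<alpha>)\<^sup>2}"
  proof clarify
    fix t assume t: "t \<in> space (lebesgue_on {0..})" "norm (f t) > \<alpha>"
    show "t \<in> {0..(N / \<alpha>)\<^sup>2}"
    proof (cases "t = 0")
      case False
      with t have "t > 0" by simp
      with bound[of t] t(2) have "\<alpha> < N / sqrt t" by linarith
      with \<open>t > 0\<close> \<alpha> have "sqrt t < N / \<alpha>" by (simp add: field_simps)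
      then have "t \<le> (N / \<alpha>)\<^sup>2"
        by (meson less_imp_le real_less_lsqrt sqrt_le_D)
      with \<open>t > 0\<close> show ?thesis by simp
    qed simp
  qed
  then have "distribution_function (lebesgue_on {0..}) f \<alpha> \<le> emeasure (lebesgue_on {0..}) {0..(N / \<alpha>)\<^sup>2}"
    unfolding distribution_function_def
    by (rule emeasure_mono) (auto simp: sets_restrict_space_iff)
  also have "\<dots> = ennreal ((N / \<alpha>)\<^sup>2)"
    by (simp add: emeasure_lebesgue_on_Icc)
  finally have "ennreal_sqrt (distribution_function (lebesgue_on {0..}) f \<alpha>) \<le> ennreal (N / \<alpha>)"
    using ennreal_sqrt_mono[of _ "ennreal ((N / \<alpha>)\<^sup>2)"] assms(1) \<alpha> by (simp add: ennreal_sqrt_ennreal)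
  then have "ennreal \<alpha> * ennreal_sqrt (distribution_function (lebesgue_on {0..}) f \<alpha>) \<le> ennreal \<alpha> * ennreal (N / \<alpha>)"
    by (rule mult_left_mono) simp
  also have "\<dots> = ennreal N"
    using \<alpha> assms(1) by (simp flip: ennreal_mult)
  finally show "ennreal \<alpha> * ennreal_sqrt (distribution_function (lebesgue_on {0..}) f \<alpha>) \<le> ennreal N" .
qed

text \<open>Chebyshev's argument: if \<open>norm (f s)\<close> exceeded
  \<open>1 / sqrt (b - a)\<close> on all of \<open>{a..b}\<close>, this level alone would make the
  quasi-norm at least 1.\<close>

lemma weak_L2_norm_less_imp_small_value:
  assumes meas: "f \<in> borel_measurable (lebesgue_on {0..})"
    and norm: "weak_L2_norm (lebesgue_on {0..}) f < 1"
    and ab: "0 \<le> a" "a < b"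
  obtains s where "s \<in> {a..b}" "norm (f s) * sqrt (b - a) \<le> 1"
proof (rule ccontr)
  assume "\<not> thesis"
  with that have large: "norm (f s) * sqrt (b - a) > 1" if "s \<in> {a..b}" for s
    using \<open>s \<in> {a..b}\<close> by (meson not_le)
  define \<alpha> where "\<alpha> = 1 / sqrt (b - a)"
  have \<alpha>: "\<alpha> > 0"
    using ab by (simp add: \<alpha>_def)
  have "{a..b} \<subseteq> {t \<in> space (lebesgue_on {0..}). norm (f t) > \<alpha>}"
    using ab large by (auto simp: \<alpha>_def field_simps)
  moreover have "{t \<in> space (lebesgue_on {0..}). norm (f t) > \<alpha>} \<in> sets (lebesgue_on {0..})"
  proof -
    have "open {y :: 'a. norm y > \<alpha>}"
      by (intro open_Collect_less continuous_intros)
    from measurable_sets[OF meas borel_open[OF this]] show ?thesis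
      by (simp add: vimage_def Int_def conj_commute)
  qed
  ultimately have "ennreal (b - a) \<le> distribution_function (lebesgue_on {0..}) f \<alpha>"
    unfolding distribution_function_def
    using ab emeasure_mono emeasure_lebesgue_on_Icc[of a b] by (metis less_imp_le)
  then have "ennreal (sqrt (b - a)) \<le> ennreal_sqrt (distribution_function (lebesgue_on {0..}) f \<alpha>)"
    using ab ennreal_sqrt_mono ennreal_sqrt_ennreal[of "b - a"] by fastforce
  then have "ennreal \<alpha> * ennreal (sqrt (b - a))
      \<le> ennreal \<alpha> * ennreal_sqrt (distribution_function (lebesgue_on {0..}) f \<alpha>)"
    by (rule mult_left_mono) simp
  also have "\<dots> \<le> weak_L2_norm (lebesgue_on {0..}) f"
    unfolding weak_L2_norm_def using \<alpha> by (intro SUP_upper) simp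
  also have "ennreal \<alpha> * ennreal (sqrt (b - a)) = 1"
    using ab by (simp add: \<alpha>_def flip: ennreal_mult)
  finally show False
    using norm by simp
qed

section \<open>Observation operators\<close>

locale observed_semigroup = stable_analytic_semigroup T D A
  for T :: "real \<Rightarrow> 'a::complex_banach \<Rightarrow> 'a" and D A +
  fixes C :: "'a \<Rightarrow> 'b::complex_banach"
  assumes C_clinear: "clinear_on D C"
    and C_graph_bounded: "graph_bounded D A C"
begin

section \<open>Boundedness and continuity of the observed orbits\<close>

lemma C_add: "x \<in> D \<Longrightarrow> y \<in> D \<Longrightarrow> C (x + y) = C x + C y"
  and C_scaleC: "x \<in> D \<Longrightarrow> C (c *\<^sub>C x) = c *\<^sub>C C x"
  using C_clinear by (auto simp: clinear_on_def)

lemma C_scaleR: "x \<in> D \<Longrightarrow> C (r *\<^sub>R x) = r *\<^sub>R C x"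
  using C_scaleC[of x "of_real r"] by (simp add: scaleC_of_real)

lemma C_diff: "x \<in> D \<Longrightarrow> y \<in> D \<Longrightarrow> C (x - y) = C x - C y"
  using C_add[of x "(- 1) *\<^sub>C y"] D_scaleC[of y "- 1"] C_scaleC[of y "- 1"]
  by (simp add: scaleC_minus_left)

text \<open>The identity \<open>A R x = x - \<mu> R x\<close> for the resolvent \<open>R\<close>
  bounds the graph norm of \<open>R x\<close> by a multiple of \<open>norm x\<close>.\<close>

lemma bounded_clinear_C_resolvent:
  assumes "Re \<mu> \<ge> 0"
  shows "bounded_clinear (\<lambda>x. C (shifted_inverse D A \<mu> x))"
proof -
  let ?R = "shifted_inverse D A \<mu>"
  note in_D = resolvent_D[OF assms]
  have R: "bounded_linear ?R" "\<And>c x. ?R (c *\<^sub>C x) = c *\<^sub>C ?R x"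
    using bounded_clinear_resolvent[OF assms] by (auto simp: bounded_clinear_def)
  obtain L where L: "L \<ge> 0" "\<And>x. norm (?R x) \<le> L * norm x"
    using bounded_linear_imp_norm_bound[OF R(1)] by blast
  obtain K where K: "\<And>x. x \<in> D \<Longrightarrow> norm (C x) \<le> K * (norm x + norm (A x))"
    using C_graph_bounded unfolding graph_bounded_def by blast
  have "bounded_linear (\<lambda>x. C (?R x))"
  proof (rule bounded_linear_intro)
    fix x y :: 'a and r :: real
    show "C (?R (x + y)) = C (?R x) + C (?R y)" "C (?R (r *\<^sub>R x)) = r *\<^sub>R C (?R x)"
      by (simp_all add: linear_simps[OF R(1)] C_add C_scaleR in_D)
    have "A (?R x) = x - \<mu> *\<^sub>C ?R x"
      using resolvent_right[OF assms, of x] by (simp add: algebra_simps)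
    then have "norm (A (?R x)) \<le> norm x + norm (\<mu> *\<^sub>C ?R x)"
      using norm_triangle_ineq4[of x "\<mu> *\<^sub>C ?R x"] by simp
    also have "\<dots> \<le> norm x + cmod \<mu> * (L * norm x)"
      using L(2)[of x] by (simp add: norm_scaleC mult_left_mono)
    finally have "norm (?R x) + norm (A (?R x)) \<le> L * norm x + (norm x + cmod \<mu> * (L * norm x))"
      using L(2)[of x] by linarith
    then have "\<bar>K\<bar> * (norm (?R x) + norm (A (?R x))) \<le> \<bar>K\<bar> * (L * norm x + (norm x + cmod \<mu> * (L * norm x)))"
      by (rule mult_left_mono) simp
    moreover have "norm (C (?R x)) \<le> \<bar>K\<bar> * (norm (?R x) + norm (A (?R x)))"
      by (rule order_trans[OF K[OF in_D]]) (intro mult_right_mono, auto)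
    ultimately show "norm (C (?R x)) \<le> norm x * (\<bar>K\<bar> * (L + (1 + cmod \<mu> * L)))"
      by (simp add: algebra_simps)
  qed
  then show ?thesis
    unfolding bounded_clinear_def by (simp add: R(2) C_scaleC in_D)
qed

text \<open>Trades the unbounded \<open>C\<close> for a bounded operator applied to
  \<open>(\<mu> + A) T(t) x\<close>.\<close>

lemma C_T_eq_C_resolvent:
  assumes "Re \<mu> \<ge> 0" "t > 0"
  shows "C (T t x) = C (shifted_inverse D A \<mu> (\<mu> *\<^sub>C T t x + A (T t x)))"
  using assms by (simp add: resolvent_left T_in_D)

text \<open>The case \<open>\<mu> = 0\<close> of the factorization, with the estimate of
  \<open>A (T t x)\<close>. This crude rate starts the iteration that proves the parabolic bound
  from admissibility.\<close>

lemma C_T_bound: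
  obtains a where "a \<ge> 0" "\<And>t x. t > 0 \<Longrightarrow> norm (C (T t x)) \<le> a / t * norm x"
proof -
  obtain c where c: "c \<ge> 0" "\<And>t x. t > 0 \<Longrightarrow> norm (A (T t x)) \<le> c / t * norm x"
    using A_T_bound by blast
  have "bounded_linear (\<lambda>x. C (shifted_inverse D A 0 x))"
    using bounded_clinear_C_resolvent[of 0] by (simp add: bounded_clinear_def)
  then obtain K where K: "K \<ge> 0" "\<And>x. norm (C (shifted_inverse D A 0 x)) \<le> K * norm x"
    using bounded_linear_imp_norm_bound by blast
  have "norm (C (T t x)) \<le> K * c / t * norm x" if "t > 0" for t x
  proof -
    have "norm (C (T t x)) \<le> K * norm (A (T t x))"
      using C_T_eq_C_resolvent[of 0 t x] that K(2)[of "A (T t x)"] by simp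
    also have "\<dots> \<le> K * (c / t * norm x)"
      using c(2)[OF that] K(1) by (rule mult_left_mono)
    finally show ?thesis by simp
  qed
  then show ?thesis
    using that[of "K * c"] K c by simp
qed

lemma continuous_on_C_T: "continuous_on {0<..} (\<lambda>t. C (T t x))"
proof (intro continuous_at_imp_continuous_on ballI)
  fix t :: real assume "t \<in> {0<..}"
  then have t: "t > 0" by simp
  have C: "bounded_linear (\<lambda>x. C (shifted_inverse D A 0 x))"
    using bounded_clinear_C_resolvent[of 0] by (simp add: bounded_clinear_def)
  \<comment> \<open>Near \<open>t\<close> the vector \<open>A (T u x)\<close> is the orbit of the
    fixed vector \<open>A (T (t / 2) x)\<close>, hence continuous in \<open>u\<close>.\<close>
  have "continuous_on {t / 2<..} (\<lambda>u. T (u - t / 2) (A (T (t / 2) x)))"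
    by (rule continuous_on_compose2[OF continuous_on_T]) (auto intro!: continuous_intros)
  from bounded_linear.continuous_on[OF C this]
  have "continuous_on {t / 2<..} (\<lambda>u. C (T u x))"
  proof (rule continuous_on_eq)
    fix u assume u: "u \<in> {t / 2<..}"
    have "T (u - t / 2) (A (T (t / 2) x)) = A (T (u - t / 2) (T (t / 2) x))"
      using u t by (simp add: T_D T_in_D)
    also have "\<dots> = A (T u x)"
      using u t T_add[of "u - t / 2" "t / 2"] by simp
    finally show "C (shifted_inverse D A 0 (T (u - t / 2) (A (T (t / 2) x)))) = C (T u x)"
      using C_T_eq_C_resolvent[of 0 u x] u t by simp
  qed
  then show "isCont (\<lambda>t. C (T t x)) t"
    using t by (simp add: continuous_on_eq_continuous_at)
qed

section \<open>The Weiss condition and the parabolic bound\<close>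

definition parabolic_bound :: "real \<Rightarrow> bool"
  where "parabolic_bound K \<longleftrightarrow> (\<forall>t>0. \<forall>x. norm (C (T t x)) \<le> K / sqrt t * norm x)"

lemma weiss_imp_parabolic:
  assumes "weiss_condition D A C"
  shows "\<exists>K>0. parabolic_bound K"
proof -
  let ?G = "\<lambda>\<mu> x. sqrt (Re \<mu>) *\<^sub>R C (shifted_inverse D A \<mu> x)"
  obtain K where K: "\<And>\<mu>. Re \<mu> > 0 \<Longrightarrow> onorm (?G \<mu>) \<le> K"
    using assms unfolding weiss_condition_def bdd_above_def by auto
  \<comment> \<open>The maximum with 1 keeps the final constant strictly positive.\<close>
  have G: "norm (?G \<mu> x) \<le> max K 1 * norm x" if "Re \<mu> > 0" for \<mu> x
  proof -
    have "bounded_linear (?G \<mu>)"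
      using assms that by (simp add: weiss_condition_def bounded_clinear_def)
    from onorm[OF this, of x] show ?thesis
      by (rule order_trans) (use K[OF that] in \<open>auto intro: mult_right_mono\<close>)
  qed
  obtain c where c: "c \<ge> 0" "\<And>t x. t > 0 \<Longrightarrow> norm (A (T t x)) \<le> c / t * norm x"
    using A_T_bound by blast
  obtain M where M: "M \<ge> 1" "\<And>t x. t \<ge> 0 \<Longrightarrow> norm (T t x) \<le> M * norm x"
    using T_uniform_bound by blast
  have "norm (C (T t x)) \<le> (max K 1 * (M + c)) / sqrt t * norm x" if t: "t > 0" for t x
  proof -
    \<comment> \<open>With this choice both summands of \<open>?y\<close> are of order
      \<open>1 / t\<close>.\<close>
    let ?\<mu> = "complex_of_real (1 / t)"
    let ?y = "?\<mu> *\<^sub>C T t x + A (T t x)"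
    have "norm ?y \<le> norm (?\<mu> *\<^sub>C T t x) + norm (A (T t x))"
      by (rule norm_triangle_ineq)
    also have "norm (?\<mu> *\<^sub>C T t x) \<le> M / t * norm x"
      using M(2)[of t x] t by (simp add: norm_scaleC norm_divide divide_right_mono)
    also have "norm (A (T t x)) \<le> c / t * norm x"
      by (rule c(2)[OF t])
    finally have y: "norm ?y \<le> (M + c) / t * norm x"
      by (simp add: distrib_right add_divide_distrib)
    have "norm (C (T t x)) = sqrt t * norm (?G ?\<mu> ?y)"
      using C_T_eq_C_resolvent[of ?\<mu> t x] t by (simp add: real_sqrt_divide)
    also have "\<dots> \<le> sqrt t * (max K 1 * norm ?y)"
      using G[of ?\<mu> ?y] t by (intro mult_left_mono) auto
    also have "\<dots> \<le> sqrt t * (max K 1 * ((M + c) / t * norm x))"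
      using y t by (intro mult_left_mono) auto
    also have "\<dots> = (sqrt t / t) * (max K 1 * (M + c)) * norm x"
      by (simp add: mult_ac)
    also have "sqrt t / t = 1 / sqrt t"
      using t by (simp add: field_simps)
    finally show ?thesis by (simp add: mult_ac)
  qed
  moreover have "max K 1 * (M + c) > 0"
    using M c by (intro mult_pos_pos) auto
  ultimately show ?thesis
    unfolding parabolic_bound_def by blast
qed

lemma parabolic_imp_weiss:
  assumes K: "K > 0" and par: "parabolic_bound K"
  shows "weiss_condition D A C"
proof -
  have bound: "norm (C (shifted_inverse D A \<mu> x)) \<le> 3 * (K * norm x) / sqrt (Re \<mu>)" if \<mu>: "Re \<mu> > 0" for \<mu> x
  proof -
    define a where "a = Re \<mu>"
    define N where "N = K * norm x"
    have a: "a > 0" and N: "N \<ge> 0"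
      using \<mu> K by (auto simp: a_def N_def)
    let ?B = "\<lambda>x. C (shifted_inverse D A \<mu> x)"
    have B: "bounded_linear ?B" "\<And>c x. ?B (c *\<^sub>C x) = c *\<^sub>C ?B x"
      using bounded_clinear_C_resolvent[of \<mu>] \<mu> by (auto simp: bounded_clinear_def)
    define f where "f t = ?B (exp (- \<mu> * of_real t) *\<^sub>C T t x)" for t
    have f_cont: "continuous_on {0..} f"
      unfolding f_def
      by (intro bounded_linear.continuous_on[OF B(1)] continuous_intros continuous_on_T)
    have f_deriv: "(f has_vector_derivative - (exp (- \<mu> * of_real t) *\<^sub>C C (T t x))) (at t)" if t: "t > 0" for t
    proof -
      have "((\<lambda>z. exp (- \<mu> * z)) has_field_derivative - \<mu> * exp (- \<mu> * of_real t)) (at (of_real t))"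
        by (auto intro!: derivative_eq_intros)
      from bounded_bilinear.has_vector_derivative[OF bounded_bilinear_scaleC
          has_vector_derivative_real_field[OF this] T_has_vector_derivative[OF t]]
      have "((\<lambda>t. exp (- \<mu> * of_real t) *\<^sub>C T t x) has_vector_derivative
          exp (- \<mu> * of_real t) *\<^sub>C (- A (T t x)) + (- \<mu> * exp (- \<mu> * of_real t)) *\<^sub>C T t x) (at t)" .
      from bounded_linear.has_vector_derivative[OF B(1) this]
      have "(f has_vector_derivative
          ?B (exp (- \<mu> * of_real t) *\<^sub>C (- A (T t x)) + (- \<mu> * exp (- \<mu> * of_real t)) *\<^sub>C T t x)) (at t)"
        unfolding f_def .
      moreover have "exp (- \<mu> * of_real t) *\<^sub>C (- A (T t x)) + (- \<mu> * exp (- \<mu> * of_real t)) *\<^sub>C T t x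
          = - (exp (- \<mu> * of_real t) *\<^sub>C (\<mu> *\<^sub>C T t x + A (T t x)))"
        by (simp add: scaleC_minus_right scaleC_minus_left scaleC_add_right scaleC_scaleC mult.commute)
      \<comment> \<open>The resolvent inside \<open>?B\<close> cancels \<open>\<mu> + A\<close>, so
        the derivative involves only \<open>C (T t x)\<close>.\<close>
      moreover have "?B (\<mu> *\<^sub>C T t x + A (T t x)) = C (T t x)"
        using C_T_eq_C_resolvent[of \<mu> t x] \<mu> t by simp
      ultimately show ?thesis
        by (simp only: linear_simps(4)[OF B(1)] B(2))
    qed
    have f_deriv_bound: "norm (- (exp (- \<mu> * of_real t) *\<^sub>C C (T t x))) \<le> exp (- a * t) * (N / sqrt t)" if "t > 0" for t
    proof -
      have "norm (C (T t x)) \<le> N / sqrt t"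
        using par that by (simp add: parabolic_bound_def N_def)
      then have "exp (- a * t) * norm (C (T t x)) \<le> exp (- a * t) * (N / sqrt t)"
        by (rule mult_left_mono) simp
      then show ?thesis
        by (simp add: norm_scaleC a_def)
    qed
    \<comment> \<open>Here the exponential is bounded by 1. The majorant
      \<open>2 * N * sqrt t\<close> stays continuous at 0, although its derivative blows up
      there.\<close>
    have near: "norm (f (1 / a) - f 0) \<le> 2 * N * sqrt (1 / a) - 2 * N * sqrt 0"
    proof (rule differentiable_bound_general[where \<phi>="\<lambda>t. 2 * N * sqrt t" and \<phi>'="\<lambda>t. N / sqrt t"])
      fix t assume t: "0 < t" "t < 1 / a"
      show "(f has_vector_derivative - (exp (- \<mu> * of_real t) *\<^sub>C C (T t x))) (at t)"
        by (rule f_deriv) fact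
      show "((\<lambda>t. 2 * N * sqrt t) has_vector_derivative N / sqrt t) (at t)"
        unfolding has_real_derivative_iff_has_vector_derivative[symmetric]
        using t by (auto intro!: derivative_eq_intros simp: field_simps)
      have "exp (- a * t) * (N / sqrt t) \<le> 1 * (N / sqrt t)"
        using a t N by (intro mult_right_mono) auto
      with f_deriv_bound[OF t(1)] show "norm (- (exp (- \<mu> * of_real t) *\<^sub>C C (T t x))) \<le> N / sqrt t"
        by simp
    qed (use a in \<open>auto intro!: continuous_intros continuous_on_subset[OF f_cont]\<close>)
    \<comment> \<open>Beyond \<open>1 / a\<close> one has \<open>1 / sqrt t \<le> sqrt a\<close>,
      and the exponential becomes integrable up to infinity with total at most
      \<open>N / sqrt a\<close>.\<close>
    have far: "norm (f b - f (1 / a)) \<le> N / sqrt a" if b: "b > 1 / a" for b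
    proof -
      have "norm (f b - f (1 / a)) \<le> - (N / sqrt a * exp (- a * b)) - - (N / sqrt a * exp (- a * (1 / a)))"
      proof (rule differentiable_bound_general[where \<phi>="\<lambda>t. - (N / sqrt a * exp (- a * t))"
            and \<phi>'="\<lambda>t. exp (- a * t) * (N * sqrt a)"])
        fix t assume t: "1 / a < t" "t < b"
        have "0 < 1 / a" using a by simp
        with t have t0: "t > 0" by linarith
        show "(f has_vector_derivative - (exp (- \<mu> * of_real t) *\<^sub>C C (T t x))) (at t)"
          by (rule f_deriv) fact
        have "N / sqrt a * (a * exp (- a * t)) = exp (- a * t) * (N * (a / sqrt a))"
          by simp
        also have "a / sqrt a = sqrt a"
          using a by (simp add: real_div_sqrt)
        finally have eq: "N / sqrt a * (a * exp (- a * t)) = exp (- a * t) * (N * sqrt a)" .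
        have "((\<lambda>t. - (k * exp (- a * t))) has_real_derivative k * (a * exp (- a * t))) (at t)" for k
          by (auto intro!: derivative_eq_intros)
        from this[of "N / sqrt a", unfolded eq]
        show "((\<lambda>t. - (N / sqrt a * exp (- a * t))) has_vector_derivative exp (- a * t) * (N * sqrt a)) (at t)"
          unfolding has_real_derivative_iff_has_vector_derivative .
        have "1 / sqrt t \<le> sqrt a"
        proof -
          have "1 \<le> a * t"
            using t a by (simp add: field_simps)
          then have "1 \<le> sqrt a * sqrt t"
            by (simp add: real_sqrt_mult[symmetric])
          then show ?thesis
            using t0 by (simp add: field_simps)
        qed
        then have "N * (1 / sqrt t) \<le> N * sqrt a"
          using N by (rule mult_left_mono)
        then have "exp (- a * t) * (N / sqrt t) \<le> exp (- a * t) * (N * sqrt a)"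
          by (intro mult_left_mono) auto
        with f_deriv_bound[OF t0]
        show "norm (- (exp (- \<mu> * of_real t) *\<^sub>C C (T t x))) \<le> exp (- a * t) * (N * sqrt a)"
          by linarith
      next
        show "continuous_on {1 / a..b} f"
          by (rule continuous_on_subset[OF f_cont]) (use a in \<open>auto intro: order_trans[of 0 "1 / a"]\<close>)
      qed (use a b in \<open>auto intro!: continuous_intros\<close>)
      also have "\<dots> \<le> N / sqrt a * 1"
      proof -
        have "exp (- a * (1 / a)) \<le> 1"
          using a by simp
        then have "N / sqrt a * exp (- a * (1 / a)) \<le> N / sqrt a * 1"
          using N a by (intro mult_left_mono) auto
        moreover have "N / sqrt a * exp (- a * b) \<ge> 0"
          using N a by simp
        ultimately show ?thesis by linarith
      qed
      finally show ?thesis by simp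
    qed
    have f_lim: "((\<lambda>b. norm (f b)) \<longlongrightarrow> 0) at_top"
    proof -
      obtain M \<omega> where M: "M \<ge> 1" "\<omega> > 0" "\<And>t x. t \<ge> 0 \<Longrightarrow> norm (T t x) \<le> M * exp (- \<omega> * t) * norm x"
        using T_bound by blast
      obtain L where L: "L \<ge> 0" "\<And>x. norm (?B x) \<le> L * norm x"
        using bounded_linear_imp_norm_bound[OF B(1)] by blast
      have "norm (norm (f b)) \<le> L * (M * norm x) * exp (- \<omega> * b)" if "b \<ge> 0" for b
      proof -
        have "cmod (exp (- \<mu> * of_real b)) \<le> 1"
          using \<mu> that by simp
        then have "norm (exp (- \<mu> * of_real b) *\<^sub>C T b x) \<le> norm (T b x)"
          by (simp add: norm_scaleC mult_left_le_one_le)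
        then have "L * norm (exp (- \<mu> * of_real b) *\<^sub>C T b x) \<le> L * (M * exp (- \<omega> * b) * norm x)"
          using M(3)[OF that, of x] L(1) by (intro mult_left_mono) auto
        then show ?thesis
          using L(2)[of "exp (- \<mu> * of_real b) *\<^sub>C T b x"] by (simp add: f_def mult_ac)
      qed
      then have "\<forall>\<^sub>F b in at_top. norm (norm (f b)) \<le> L * (M * norm x) * exp (- \<omega> * b)"
        using eventually_ge_at_top[of 0] by (rule eventually_mono[rotated])
      moreover have "((\<lambda>b. L * (M * norm x) * exp (- \<omega> * b)) \<longlongrightarrow> 0) at_top"
      proof -
        have "filterlim (\<lambda>b. - \<omega> * b) at_bot at_top"
          using M by (intro filterlim_tendsto_neg_mult_at_bot[OF tendsto_const] filterlim_ident) auto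
        then show ?thesis
          by (intro tendsto_mult_right_zero filterlim_compose[OF exp_at_bot])
      qed
      ultimately show ?thesis
        by (rule Lim_null_comparison)
    qed
    \<comment> \<open>The 3 collects 2 from the near part and 1 from the far part; letting
      \<open>b\<close> tend to infinity removes \<open>f b\<close>.\<close>
    have "norm (f 0) - 3 * N / sqrt a \<le> norm (f b)" if "b > 1 / a" for b
    proof -
      have "norm (f 0) \<le> norm (f (1 / a)) + norm (f (1 / a) - f 0)"
        by (metis norm_minus_commute norm_triangle_sub)
      moreover have "norm (f (1 / a)) \<le> norm (f b) + norm (f b - f (1 / a))"
        by (metis norm_minus_commute norm_triangle_sub)
      moreover have "norm (f (1 / a) - f 0) \<le> 2 * N / sqrt a"
        using near by (simp add: real_sqrt_divide)
      moreover have "3 * N / sqrt a = 2 * N / sqrt a + N / sqrt a"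
        by (simp add: add_divide_distrib[symmetric])
      ultimately show ?thesis
        using far[OF that] by linarith
    qed
    then have "\<forall>\<^sub>F b in at_top. norm (f 0) - 3 * N / sqrt a \<le> norm (f b)"
      using eventually_gt_at_top[of "1 / a"] by (rule eventually_mono[rotated])
    from tendsto_lowerbound[OF f_lim this] have "norm (f 0) \<le> 3 * N / sqrt a"
      by simp
    then show ?thesis
      by (simp add: f_def N_def a_def)
  qed
  show ?thesis
    unfolding weiss_condition_def
  proof (intro conjI allI impI bdd_aboveI2)
    fix \<mu> :: complex assume \<mu>: "0 < Re \<mu>"
    show "bounded_clinear (\<lambda>x. sqrt (Re \<mu>) *\<^sub>R C (shifted_inverse D A \<mu> x))"
      using bounded_clinear_C_resolvent[of \<mu>] \<mu>
      unfolding bounded_clinear_def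
      by (auto intro: bounded_linear_compose[OF bounded_linear_scaleR_right] simp: scaleC_scaleR)
  next
    fix \<mu> :: complex assume \<mu>: "\<mu> \<in> {\<mu>. 0 < Re \<mu>}"
    show "onorm (\<lambda>x. sqrt (Re \<mu>) *\<^sub>R C (shifted_inverse D A \<mu> x)) \<le> 3 * K"
      by (rule onorm_bound) (use \<mu> K bound[of \<mu>] in \<open>auto simp: field_simps\<close>)
  qed
qed

section \<open>Weak admissibility and the parabolic bound\<close>

lemma parabolic_imp_admissible:
  assumes K: "K > 0" and par: "parabolic_bound K"
  shows "weak_L2_admissible T C"
proof -
  \<comment> \<open>Linearity turns the difference of two orbits into the orbit of
    \<open>y - x\<close>, which gives a Lipschitz estimate in the quasi-norm.\<close>
  have diff_norm: "weak_L2_norm (lebesgue_on {0..}) (\<lambda>t. C (T t y) - C (T t x)) \<le> ennreal (K * norm (y - x))" for x y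
  proof (rule weak_L2_norm_le)
    fix t :: real assume t: "t > 0"
    have "C (T t y) - C (T t x) = C (T t (y - x))"
      using t by (simp add: linear_T C_diff T_in_D)
    then show "norm (C (T t y) - C (T t x)) \<le> K * norm (y - x) / sqrt t"
      using par t by (simp add: parabolic_bound_def)
  qed (use K in simp)
  show ?thesis
    unfolding weak_L2_admissible_def
  proof (intro conjI allI)
    fix x
    have "weak_L2_norm (lebesgue_on {0..}) (\<lambda>t. C (T t x)) \<le> ennreal (K * norm x)"
      by (rule weak_L2_norm_le) (use K par in \<open>auto simp: parabolic_bound_def\<close>)
    then have "weak_L2_norm (lebesgue_on {0..}) (\<lambda>t. C (T t x)) < \<infinity>"
      by (rule le_less_trans) simp
    then show "(\<lambda>t. C (T t x)) \<in> weak_L2 (lebesgue_on {0..})"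
      by (simp add: weak_L2_def borel_measurable_lebesgue_on_continuous[OF continuous_on_C_T])
    have "((\<lambda>y. ennreal (K * norm (y - x))) \<longlongrightarrow> ennreal (K * norm (x - x))) (at x)"
      by (intro tendsto_ennrealI tendsto_intros)
    then have lim: "((\<lambda>y. ennreal (K * norm (y - x))) \<longlongrightarrow> 0) (at x)"
      by simp
    show "((\<lambda>y. weak_L2_norm (lebesgue_on {0..}) (\<lambda>t. C (T t y) - C (T t x))) \<longlongrightarrow> 0) (at x)"
      by (rule tendsto_sandwich[OF _ _ tendsto_const lim]) (simp_all add: diff_norm)
  qed
qed

text \<open>
  A small weak norm makes \<open>C (T s x)\<close> small for some \<open>s\<close> slightly below \<open>t\<close>, and analyticity
  writes the error \<open>T t x - T s x\<close> as \<open>T (t / 2) y\<close> with a short vector \<open>y\<close>.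
\<close>

lemma admissible_imp_halving:
  assumes "weak_L2_admissible T C"
  obtains K where "K \<ge> 0"
    "\<And>t x. t > 0 \<Longrightarrow> \<exists>y. norm y \<le> norm x / 3 \<and>
      norm (C (T t x)) \<le> K / sqrt t * norm x + norm (C (T (t / 2) y))"
proof -
  \<comment> \<open>Continuity is used at the point 0 only; the subtracted term vanishes for
    \<open>t > 0\<close>.\<close>
  let ?f = "\<lambda>y t. C (T t y) - C (T t 0)"
  have f: "?f y t = C (T t y)" if "t > 0" for t y
    using that C_diff[OF T_in_D T_in_D, of t t y y] C_diff[OF T_in_D T_in_D, of t t 0 0]
    by (simp add: linear_T)
  have "((\<lambda>y. weak_L2_norm (lebesgue_on {0..}) (?f y)) \<longlongrightarrow> 0) (at 0)"
    using assms by (simp add: weak_L2_admissible_def)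
  then have "\<forall>\<^sub>F y in at 0. weak_L2_norm (lebesgue_on {0..}) (?f y) < 1"
    by (rule order_tendstoD) simp
  then obtain \<delta> where \<delta>: "\<delta> > 0"
    "\<And>y. y \<noteq> 0 \<Longrightarrow> dist y 0 < \<delta> \<Longrightarrow> weak_L2_norm (lebesgue_on {0..}) (?f y) < 1"
    unfolding eventually_at by blast
  have f_meas: "?f y \<in> borel_measurable (lebesgue_on {0..})" for y
    by (intro borel_measurable_lebesgue_on_continuous continuous_intros continuous_on_C_T)
  obtain c where c: "c \<ge> 0" "\<And>t x. t > 0 \<Longrightarrow> norm (A (T t x)) \<le> c / t * norm x"
    using A_T_bound by blast
  \<comment> \<open>The bound \<open>1 / 4\<close> keeps \<open>s - t / 2\<close> at least
    \<open>t / 4\<close>; the other bound makes \<open>4 * c * \<eta>\<close> at most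
    \<open>1 / 3\<close>.\<close>
  define \<eta> where "\<eta> = min (1 / 4) (1 / (12 * (c + 1)))"
  have \<eta>: "0 < \<eta>" "\<eta> \<le> 1 / 4"
    using c by (auto simp: \<eta>_def)
  have "\<eta> * (12 * (c + 1)) \<le> 1 / (12 * (c + 1)) * (12 * (c + 1))"
    using c by (intro mult_right_mono) (auto simp: \<eta>_def)
  then have c\<eta>: "4 * c * \<eta> \<le> 1 / 3"
    using c \<eta> by (simp add: algebra_simps)
  define K where "K = 2 / (\<delta> * sqrt \<eta>)"
  have "\<exists>y. norm y \<le> norm x / 3 \<and> norm (C (T t x)) \<le> K / sqrt t * norm x + norm (C (T (t / 2) y))"
    if t: "t > 0" for t x
  proof (cases "x = 0")
    case True
    have "C (T t 0) = 0"
      using C_diff[OF T_in_D T_in_D, of t t 0 0] t by (simp add: linear_T)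
    then show ?thesis
      using True by (intro exI[of _ 0]) simp
  next
    case False
    \<comment> \<open>Scales \<open>x\<close> to length \<open>\<delta> / 2\<close>; undoing the
      scaling produces the constant \<open>K\<close>.\<close>
    define r where "r = \<delta> / (2 * norm x)"
    have r: "r > 0" "r * norm x = \<delta> / 2"
      using False \<delta> by (auto simp: r_def)
    have small: "weak_L2_norm (lebesgue_on {0..}) (?f (r *\<^sub>R x)) < 1"
      using False r \<delta> by (intro \<delta>(2)) auto
    have "t - \<eta> * t \<ge> 3 / 4 * t"
      using \<eta> t by simp
    then have "0 \<le> t - \<eta> * t" "t - \<eta> * t < t"
      using \<eta> t by auto
    from weak_L2_norm_less_imp_small_value[OF f_meas small this]
    obtain s where s: "s \<in> {t - \<eta> * t..t}" "norm (?f (r *\<^sub>R x) s) * sqrt (t - (t - \<eta> * t)) \<le> 1"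
      by blast
    have s34: "s \<ge> 3 / 4 * t"
      using s(1) \<open>t - \<eta> * t \<ge> 3 / 4 * t\<close> by simp
    then have s0: "s > 0"
      using t by linarith
    have "?f (r *\<^sub>R x) s = r *\<^sub>R C (T s x)"
      using s0 by (simp only: f) (simp add: linear_T C_scaleR T_in_D)
    then have "r * norm (C (T s x)) * (sqrt \<eta> * sqrt t) \<le> 1"
      using s(2) r by (simp add: real_sqrt_mult)
    then have "norm (C (T s x)) \<le> 1 / (r * (sqrt \<eta> * sqrt t))"
      using r \<eta> t by (simp add: field_simps)
    also have "\<dots> = K / sqrt t * norm x"
      using False \<delta> by (simp add: K_def r_def)
    finally have Cs: "norm (C (T s x)) \<le> K / sqrt t * norm x" .
    define y where "y = T (t / 2) x - T (s - t / 2) x"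
    \<comment> \<open>Mean value inequality on \<open>{t / 4..}\<close>, where the derivative of the
      orbit is at most \<open>4 * c / t * norm x\<close>.\<close>
    have "norm y \<le> 4 * c / t * norm x * norm (t / 2 - (s - t / 2))"
      unfolding y_def
    proof (rule differentiable_bound[of "{t / 4..}"])
      fix u assume u: "u \<in> {t / 4..}"
      then have u0: "u > 0"
        using t by auto
      show "((\<lambda>u. T u x) has_derivative (\<lambda>h. h *\<^sub>R (- A (T u x)))) (at u within {t / 4..})"
        using T_has_vector_derivative[OF u0] unfolding has_vector_derivative_def
        by (rule has_derivative_at_withinI)
      have "c / u \<le> 4 * c / t"
        using c(1) u t u0 by (simp add: field_simps mult_left_mono)
      then have "norm (A (T u x)) \<le> 4 * c / t * norm x"
        using c(2)[OF u0, of x] by (meson mult_right_mono norm_ge_zero order_trans)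
      then have "norm (h *\<^sub>R (- A (T u x))) \<le> 4 * c / t * norm x * norm h" for h
        using mult_left_mono[of "norm (A (T u x))" "4 * c / t * norm x" "\<bar>h\<bar>"] by (simp add: mult_ac)
      then show "onorm (\<lambda>h. h *\<^sub>R (- A (T u x))) \<le> 4 * c / t * norm x"
        by (rule onorm_le)
    qed (use s34 t in auto)
    also have "\<dots> \<le> 4 * c / t * norm x * (\<eta> * t)"
      using s(1) c t by (intro mult_left_mono) auto
    also have "\<dots> = 4 * c * \<eta> * norm x"
      using t by simp
    also have "\<dots> \<le> 1 / 3 * norm x"
      using c\<eta> by (rule mult_right_mono) simp
    finally have y: "norm y \<le> norm x / 3" by simp
    have "T (t / 2) y = T t x - T s x"
      using t s34 T_add[of "t / 2" "t / 2" x] T_add[of "t / 2" "s - t / 2" x]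
      by (simp add: y_def linear_T)
    then have "C (T t x) = C (T s x) + C (T (t / 2) y)"
      using t s0 by (simp add: C_diff T_in_D)
    then have "norm (C (T t x)) \<le> norm (C (T s x)) + norm (C (T (t / 2) y))"
      by (simp add: norm_triangle_ineq)
    with Cs y show ?thesis
      by (intro exI[of _ y]) linarith
  qed
  moreover have "K \<ge> 0"
    using \<delta> \<eta> by (simp add: K_def)
  ultimately show ?thesis
    using that by blast
qed

lemma admissible_imp_parabolic:
  assumes "weak_L2_admissible T C"
  shows "\<exists>K>0. parabolic_bound K"
proof -
  obtain K where K: "K \<ge> 0"
    and halve: "\<And>t x. t > 0 \<Longrightarrow> \<exists>y. norm y \<le> norm x / 3 \<and>
      norm (C (T t x)) \<le> K / sqrt t * norm x + norm (C (T (t / 2) y))"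
    using admissible_imp_halving[OF assms] by blast
  obtain a where a: "a \<ge> 0" "\<And>t x. t > 0 \<Longrightarrow> norm (C (T t x)) \<le> a / t * norm x"
    using C_T_bound by blast
  \<comment> \<open>Each step doubles \<open>a / t\<close> and divides the vector by 3, so the crude
    term contracts by \<open>2 / 3\<close>.\<close>
  have iter: "norm (C (T t x)) \<le> (2 * K / sqrt t + (2 / 3) ^ n * (a / t)) * norm x" if "t > 0" for n t x
    using that
  proof (induction n arbitrary: t x)
    case 0
    have "a / t * norm x \<le> (2 * K / sqrt t + a / t) * norm x"
      using K 0 by (intro mult_right_mono) auto
    with a(2)[OF 0, of x] show ?case by simp
  next
    case (Suc n)
    obtain y where y: "norm y \<le> norm x / 3"
      "norm (C (T t x)) \<le> K / sqrt t * norm x + norm (C (T (t / 2) y))"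
      using halve[OF Suc.prems] by blast
    have "norm (C (T (t / 2) y)) \<le> (2 * K / sqrt (t / 2) + (2 / 3) ^ n * (a / (t / 2))) * norm y"
      using Suc.prems by (intro Suc.IH) simp
    also have "\<dots> \<le> (2 * K / sqrt (t / 2) + (2 / 3) ^ n * (a / (t / 2))) * (norm x / 3)"
      using y(1) K a(1) Suc.prems by (intro mult_left_mono) auto
    also have "\<dots> \<le> (3 * K / sqrt t + (2 / 3) ^ n * (a / (t / 2))) * (norm x / 3)"
    proof -
      \<comment> \<open>This closes the induction for \<open>2 * K\<close>: halving \<open>t\<close>
        costs \<open>sqrt 2\<close>, and \<open>K + 2 * K * (3 / 2) / 3 = 2 * K\<close>.\<close>
      have "sqrt 2 \<le> 3 / 2"
        by (rule real_le_lsqrt) (auto simp: power2_eq_square)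
      then have "2 * K / sqrt t * sqrt 2 \<le> 2 * K / sqrt t * (3 / 2)"
        using K Suc.prems by (intro mult_left_mono) auto
      then show ?thesis
        using a(1) Suc.prems by (intro mult_right_mono add_mono) (auto simp: real_sqrt_divide)
    qed
    also have "\<dots> = (K / sqrt t + (2 / 3) ^ Suc n * (a / t)) * norm x"
      using Suc.prems by (simp add: field_simps)
    finally have "norm (C (T (t / 2) y)) \<le> (K / sqrt t + (2 / 3) ^ Suc n * (a / t)) * norm x" .
    with y(2) show ?case
      by (simp add: algebra_simps)
  qed
  \<comment> \<open>Let \<open>n\<close> tend to infinity; adding 1 makes the constant positive even
    if \<open>K = 0\<close>.\<close>
  have "norm (C (T t x)) \<le> (2 * K + 1) / sqrt t * norm x" if t: "t > 0" for t x
  proof -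
    have "(\<lambda>n. (2 * K / sqrt t + (2 / 3) ^ n * (a / t)) * norm x) \<longlonglongrightarrow> (2 * K / sqrt t + 0 * (a / t)) * norm x"
      by (intro tendsto_intros LIMSEQ_realpow_zero) auto
    from LIMSEQ_le_const[OF this] iter[OF t]
    have "norm (C (T t x)) \<le> 2 * K / sqrt t * norm x"
      by auto
    also have "\<dots> \<le> (2 * K + 1) / sqrt t * norm x"
      using t by (intro mult_right_mono divide_right_mono) auto
    finally show ?thesis .
  qed
  with K show ?thesis
    unfolding parabolic_bound_def by (intro exI[of _ "2 * K + 1"]) auto
qed

end

section \<open>The equivalence of the three conditions\<close>

lemma powr_minus_half: "t > 0 \<Longrightarrow> t powr - (1 / 2) = 1 / sqrt t"
  using powr_minus[of t "1 / 2"] by (simp add: powr_half_sqrt inverse_eq_divide)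

theorem theorem2p3:
  fixes T :: "real \<Rightarrow> 'x::complex_banach \<Rightarrow> 'x"
    and D :: "'x set"
    and A :: "'x \<Rightarrow> 'x"
    and C :: "'x \<Rightarrow> 'y::complex_banach"
  assumes "analytic_semigroup T"
    and "exponentially_stable T"
    and "is_generator T D (\<lambda>x. - A x)"
    and "clinear_on D C"
    and "graph_bounded D A C"
  shows "(weiss_condition D A C \<longleftrightarrow>
           (\<exists>K>0. \<forall>t>0. \<forall>x. norm (C (T t x)) \<le> K * t powr (- 1 / 2) * norm x)) \<and>
         ((\<exists>K>0. \<forall>t>0. \<forall>x. norm (C (T t x)) \<le> K * t powr (- 1 / 2) * norm x) \<longleftrightarrow>
           weak_L2_admissible T C)"
proof -
  interpret observed_semigroup T D A C
    using assms by unfold_locales (auto simp: analytic_semigroup_def)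
  have "(\<forall>t>0. \<forall>x. norm (C (T t x)) \<le> K * t powr (- 1 / 2) * norm x) \<longleftrightarrow> parabolic_bound K" for K
    unfolding parabolic_bound_def by (auto simp: powr_minus_half)
  then show ?thesis
    using weiss_imp_parabolic parabolic_imp_weiss parabolic_imp_admissible admissible_imp_parabolic
    by metis
qed

end
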